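(* Let $R$ be a finite group and let $N$ be a non-identity proper normal subgroup of $R$. Then the set $$\{S\subseteq R \mid S=S^{-1},\ R=\mathbf{N}_{\mathrm{Aut}(\Gamma(R,S))}(R),\ \exists f\in \mathbf{N}_{\mathrm{Aut}(\Gamma(R,S))}(N)\text{ with } f\ne 1,\ 1^f=1,\ f\text{ fixes each }N\text{-orbit setwise}\}$$ has cardinality at most $2^{\mathbf{c}(R)-\frac{\sqrt{|R|}}{192}+2\log_2|R|+(\log_2|R|)^2+3}$. Moreover, if $R$ is neither abelian of exponent greater than $2$ nor generalised dicyclic, then the same upper bound holds for the set obtained by dropping the condition $R=\mathbf{N}_{\mathrm{Aut}(\Gamma(R,S))}(R)$ from the definition of the set.
   Context: For a finite group $R$ and an inverse-closed subset $S=S^{-1}\subseteq R$, the Cayley graph $\Gamma(R,S)$ has vertex set $R$ and $\{r,t\}$ is an edge if and only if $tr^{-1}\in S$. $\mathrm{Aut}(\Gamma(R,S))$ is the group of permutations of $R$ preserving the edge set. $R$ is identified with its right regular representation, a regular subgroup of $\mathrm{Aut}(\Gamma(R,S))$; correspondingly a subgroup $N\le R$ is identified with a subgroup of $\mathrm{Aut}(\Gamma(R,S))$ (acting by right multiplication), and the $N$-orbits on $R$ are the cosets of $N$. $\mathbf{N}_G(H)$ denotes the normaliser of $H$ in $G$. For a permutation $f$ of $R$ and $x\in R$, $x^f$ is the image of $x$ under $f$; in "$1^f=1$", $1$ is the vertex given by the identity element of $R$. Let $\mathbf{I}(R)=\{x\in R\mid o(x)\le 2\}$, where $o(x)$ is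 the order of $x$, and $\mathbf{c}(R)=\frac{|R|+|\mathbf{I}(R)|}{2}$. A group is generalised dicyclic if it is isomorphic to $\mathrm{Dic}(A,y,x)=\langle A,x\mid x^2=y,\ a^x=a^{-1}\ \forall a\in A\rangle$ for some abelian group $A$ of even order and exponent greater than $2$ and some involution $y\in A$. *)

theory Defs
  imports Complex_Main "HOL-Algebra.Bij" "HOL-Algebra.Group_Action"
    "HOL-Algebra.Multiplicative_Group"
begin

section \<open>Cayley graphs and their automorphism groups\<close>

text \<open>
  Edges are the sets \<open>{r, t}\<close>; when the identity lies in \<open>S\<close> every vertex carries a loop,
  represented by a singleton.
\<close>

definition cayley_edges :: "('a, 'b) monoid_scheme \<Rightarrow> 'a set \<Rightarrow> 'a set set" where
  "cayley_edges R S =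
     {{r, t} | r t. r \<in> carrier R \<and> t \<in> carrier R \<and> t \<otimes>\<^bsub>R\<^esub> inv\<^bsub>R\<^esub> r \<in> S}"

text \<open>
  The product in \<open>BijGroup\<close> is composition of functions, the opposite of the product of
  permutations acting on the right. Subgroups, normalisers and orbits are the same for both.
\<close>

definition cayley_aut :: "('a, 'b) monoid_scheme \<Rightarrow> 'a set \<Rightarrow> ('a \<Rightarrow> 'a) monoid" where
  "cayley_aut R S =
     BijGroup (carrier R)
       \<lparr>carrier := {f \<in> Bij (carrier R). (\<lambda>e. f ` e) ` cayley_edges R S = cayley_edges R S}\<rparr>"

definition right_regular :: "('a, 'b) monoid_scheme \<Rightarrow> 'a set \<Rightarrow> ('a \<Rightarrow> 'a) set" where
  "right_regular R H = (\<lambda>h. \<lambda>x\<in>carrier R. x \<otimes>\<^bsub>R\<^esub> h) ` H"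

definition right_orbits :: "('a, 'b) monoid_scheme \<Rightarrow> 'a set \<Rightarrow> 'a set set" where
  "right_orbits R H =
     orbits (BijGroup (carrier R)\<lparr>carrier := right_regular R H\<rparr>) (carrier R) (\<lambda>f. f)"


section \<open>Numerical invariants\<close>

definition ord_le_two :: "('a, 'b) monoid_scheme \<Rightarrow> 'a set" where
  "ord_le_two R = {x \<in> carrier R. group.ord R x \<le> 2}"

definition cc :: "('a, 'b) monoid_scheme \<Rightarrow> real" where
  "cc R = (real (order R) + real (card (ord_le_two R))) / 2"

text \<open>Meant for finite groups, where such an \<open>n\<close> exists.\<close>

definition group_exponent :: "('a, 'b) monoid_scheme \<Rightarrow> nat" where
  "group_exponent G = (LEAST n. 0 < n \<and> (\<forall>x\<in>carrier G. x [^]\<^bsub>G\<^esub> n = \<one>\<^bsub>G\<^esub>))"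


section \<open>Group presentations\<close>

text \<open>
  Words are lists of signed letters: \<open>(g, True)\<close> stands for the generator \<open>g\<close> and
  \<open>(g, False)\<close> for its formal inverse. A set of relations is a set of pairs of words.
\<close>

type_synonym 'g gword = "('g \<times> bool) list"

definition gwords :: "'g set \<Rightarrow> 'g gword set" where
  "gwords gens = lists (gens \<times> UNIV)"

definition pres_step :: "'g set \<Rightarrow> ('g gword \<times> 'g gword) set \<Rightarrow> ('g gword \<times> 'g gword) set" where
  "pres_step gens rels =
     {(u @ l @ v, u @ r @ v) | u v l r.
        u \<in> gwords gens \<and> v \<in> gwords gens \<and>
        (l, r) \<in> rels \<union> {([(g, b), (g, \<not> b)], []) | g b. g \<in> gens}}"

definition pres_cong :: "'g set \<Rightarrow> ('g gword \<times> 'g gword) set \<Rightarrow> ('g gword \<times> 'g gword) set" where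
  "pres_cong gens rels = Restr ((pres_step gens rels \<union> (pres_step gens rels)\<inverse>)\<^sup>*) (gwords gens)"

definition presented_group :: "'g set \<Rightarrow> ('g gword \<times> 'g gword) set \<Rightarrow> 'g gword set monoid" where
  "presented_group gens rels =
     \<lparr>carrier = gwords gens // pres_cong gens rels,
      mult = \<lambda>U V. \<Union>u\<in>U. \<Union>v\<in>V. pres_cong gens rels `` {u @ v},
      one = pres_cong gens rels `` {[]}\<rparr>"


section \<open>Generalised dicyclic groups\<close>

text \<open>
  The generators of \<open>Dic(A, y, x)\<close> are the elements \<open>Some a\<close> with \<open>a\<close> in \<open>A\<close>, subject to the
  multiplication table of \<open>A\<close>, and the extra generator \<open>x = None\<close>, subject to
  \<open>x\<^sup>2 = y\<close> and \<open>x\<^sup>-\<^sup>1 a x = a\<^sup>-\<^sup>1\<close>.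
\<close>

definition dic_relations ::
    "('a, 'b) monoid_scheme \<Rightarrow> 'a \<Rightarrow> ('a option gword \<times> 'a option gword) set" where
  "dic_relations A y =
     {([(Some a, True), (Some b, True)], [(Some (a \<otimes>\<^bsub>A\<^esub> b), True)]) | a b.
        a \<in> carrier A \<and> b \<in> carrier A}
     \<union> {([(None, True), (None, True)], [(Some y, True)])}
     \<union> {([(None, False), (Some a, True), (None, True)], [(Some a, False)]) | a. a \<in> carrier A}"

definition dic_group :: "('a, 'b) monoid_scheme \<Rightarrow> 'a \<Rightarrow> 'a option gword set monoid" where
  "dic_group A y = presented_group (insert None (Some ` carrier A)) (dic_relations A y)"

text \<open>
  \<open>A\<close> may be taken over the element type of \<open>R\<close>: it embeds in \<open>Dic(A, y, x)\<close> and so in \<open>R\<close>.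
\<close>

definition generalised_dicyclic :: "('a, 'b) monoid_scheme \<Rightarrow> bool" where
  "generalised_dicyclic R \<longleftrightarrow>
     (\<exists>(A :: 'a monoid) y.
        comm_group A \<and> finite (carrier A) \<and> even (order A) \<and> group_exponent A > 2 \<and>
        y \<in> carrier A \<and> group.ord A y = 2 \<and> R \<cong> dic_group A y)"

end

theory Submission
  imports Defs
begin

text \<open>
  It suffices to count the inverse-closed \<open>S\<close> for which the stabiliser \<open>A\<close> of \<open>1\<close> in the
  automorphism group of the Cayley graph is nontrivial. Let \<open>n = |R|\<close>. For \<open>g\<close> in \<open>A\<close> and \<open>r\<close> in
  \<open>R\<close> the shift \<open>y \<mapsto> g (y r) (g r)\<inverse>\<close> lies in \<open>A\<close> again, and for fixed \<open>r\<close> shifting permutes \<open>A\<close>. Unless \<open>R\<close> is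
  abelian of exponent greater than 2 or generalised dicyclic, at least \<open>n/36\<close> elements \<open>y\<close> have an
  \<open>A\<close>-orbit not contained in \<open>{y, y\<inverse>}\<close>, and for each of these a random \<open>g\<close> in \<open>A\<close> moves \<open>y\<close> out
  of \<open>{y, y\<inverse>}\<close> with probability at least \<open>1/3\<close>.

  Fix \<open>B\<close> and \<open>C\<close> of size about \<open>sqrt (n log n)\<close> such that every \<open>y\<close> has some \<open>e\<^sub>y\<close> in \<open>B\<close> with
  \<open>y e\<^sub>y\<close> in \<open>C\<close>. The map \<open>h y = g (y e\<^sub>y) (g e\<^sub>y)\<inverse>\<close> is determined by \<open>g\<close> on \<open>B \<union> C\<close>, so there are
  at most \<open>n\<close> to the power \<open>|B \<union> C|\<close> such maps. Membership in \<open>S\<close> is invariant under \<open>h\<close>, and some \<open>g\<close>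
  gives an \<open>h\<close> moving \<open>n/108\<close> elements \<open>y\<close> out of \<open>{y, y\<inverse>}\<close>. This leaves at most
  \<open>2 powr (c(R) - n/432)\<close> sets \<open>S\<close> for each \<open>h\<close>.

  In the two exceptional cases \<open>R\<close> has an automorphism that sends each element to itself or its
  inverse; it normalises \<open>R\<close> in every Cayley graph, so the first set is empty.
\<close>


section \<open>Counting invariant subsets\<close>

text \<open>
  The bound \<open>2 powr (|V| - |W|/2)\<close>, squared to stay in the naturals. Contracting \<open>v\<close> into \<open>p v\<close> turns at
  most one further element of \<open>W\<close> into a fixed point.
\<close>

lemma card_invariant_subsets:
  fixes p :: "'a \<Rightarrow> 'a"
  assumes "finite V" and "W \<subseteq> V" and "\<And>v. v \<in> W \<Longrightarrow> p v \<in> V \<and> p v \<noteq> v"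
  shows "(card {X. X \<subseteq> V \<and> (\<forall>v\<in>W. v \<in> X \<longleftrightarrow> p v \<in> X)})\<^sup>2 * 2 ^ card W \<le> 4 ^ card V"
  using assms
proof (induction "card V" arbitrary: V W p)
  case 0
  then have "V = {}" "W = {}" by auto
  then have "{X. X \<subseteq> V \<and> (\<forall>v\<in>W. v \<in> X \<longleftrightarrow> p v \<in> X)} = {{}}" by auto
  then show ?case using \<open>V = {}\<close> \<open>W = {}\<close> by simp
next
  case (Suc n)
  show ?case
  proof (cases "W = {}")
    case True
    then have "{X. X \<subseteq> V \<and> (\<forall>v\<in>W. v \<in> X \<longleftrightarrow> p v \<in> X)} = Pow V" by auto
    then show ?thesis
      using True \<open>finite V\<close> power_mult[of "2::nat" 2 "card V"]
      by (simp add: card_Pow power_mult [symmetric] mult.commute)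
  next
    case False
    then obtain v where v: "v \<in> W" by auto
    define V1 where "V1 = V - {v}"
    define q where "q = (\<lambda>u. if p u = v then p v else p u)"
    define W1 where "W1 = W - {v} - {u. u = p v}"
    have fW: "finite W" using Suc.prems finite_subset by blast
    have vV: "v \<in> V" "p v \<in> V" "p v \<noteq> v" using v Suc.prems by auto
    have cV1: "card V1 = n" using Suc.hyps(2) vV Suc.prems(1) by (simp add: V1_def)
    have "card W \<le> card W1 + 2"
    proof -
      have "W \<subseteq> W1 \<union> {v, p v}" by (auto simp: W1_def)
      then have "card W \<le> card (W1 \<union> {v, p v})"
        using fW by (intro card_mono) (auto simp: W1_def)
      also have "\<dots> \<le> card W1 + card {v, p v}" by (rule card_Un_le)
      also have "\<dots> \<le> card W1 + 2" by (simp add: card_insert_if)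
      finally show ?thesis .
    qed
    let ?F = "{X. X \<subseteq> V \<and> (\<forall>v\<in>W. v \<in> X \<longleftrightarrow> p v \<in> X)}"
    let ?F1 = "{X. X \<subseteq> V1 \<and> (\<forall>v\<in>W1. v \<in> X \<longleftrightarrow> q v \<in> X)}"
    have IH: "(card ?F1)\<^sup>2 * 2 ^ card W1 \<le> 4 ^ card V1"
    proof (rule Suc.hyps(1))
      show "n = card V1" using cV1 by simp
      show "finite V1" using Suc.prems by (simp add: V1_def)
      show "W1 \<subseteq> V1" using Suc.prems by (auto simp: V1_def W1_def)
      show "q u \<in> V1 \<and> q u \<noteq> u" if "u \<in> W1" for u
        using that Suc.prems(3)[of u] vV by (auto simp: W1_def V1_def q_def)
    qed
    have "card ?F \<le> card ?F1"
    proof (rule card_inj_on_le)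
      show "inj_on (\<lambda>X. X - {v}) ?F"
      proof (rule inj_onI)
        fix X Y assume X: "X \<in> ?F" and Y: "Y \<in> ?F" and eq: "X - {v} = Y - {v}"
        have "v \<in> X \<longleftrightarrow> v \<in> Y" using X Y eq v vV by blast
        then show "X = Y" using eq by blast
      qed
      show "(\<lambda>X. X - {v}) ` ?F \<subseteq> ?F1"
      proof (rule image_subsetI, rule CollectI, intro conjI ballI)
        fix X assume X: "X \<in> ?F"
        show "X - {v} \<subseteq> V1" using X by (auto simp: V1_def)
        fix u assume u: "u \<in> W1"
        then have "u \<in> W" "u \<noteq> v" by (auto simp: W1_def)
        then show "u \<in> X - {v} \<longleftrightarrow> q u \<in> X - {v}"
          using X v vV by (auto simp: q_def)
      qed
      show "finite ?F1"
        by (rule finite_subset[of _ "Pow V1"]) (use Suc.prems in \<open>auto simp: V1_def\<close>)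
    qed
    \<comment> \<open>One element less in \<open>V\<close> gains a factor 4 on the right, which pays
      for the factor \<open>2 ^ 2\<close> from the at most two elements lost in
      \<open>W\<close>.\<close>
    then have "(card ?F)\<^sup>2 * 2 ^ card W \<le> (card ?F1)\<^sup>2 * 2 ^ (card W1 + 2)"
      using \<open>card W \<le> card W1 + 2\<close> by (intro mult_mono power_mono power_increasing) auto
    also have "\<dots> \<le> 4 * 4 ^ card V1" using IH by simp
    also have "\<dots> = 4 ^ card V" using cV1 Suc.hyps(2) by (metis power_Suc)
    finally show ?thesis .
  qed
qed

section \<open>Inverse pairs and inverse-closed sets\<close>

context group
begin

definition inv_pair :: "'a \<Rightarrow> 'a set" where
  "inv_pair x = {x, inv x}"

lemma ord_le_two_eq:
  assumes "finite (carrier G)"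
  shows "ord_le_two G = {x \<in> carrier G. inv x = x}"
proof -
  have "ord x \<le> 2 \<longleftrightarrow> inv x = x" if x: "x \<in> carrier G" for x
  proof
    assume "ord x \<le> 2"
    moreover have "ord x \<ge> 1" using ord_ge_1[OF assms x] .
    ultimately consider "ord x = 1" | "ord x = 2" by linarith
    then have "x [^] (2::nat) = \<one>"
    proof cases
      case 1 then show ?thesis using ord_eq_1[OF x] by simp
    next
      case 2 then show ?thesis using pow_ord_eq_1[OF x] by simp
    qed
    then have "x \<otimes> x = \<one>" using x by (simp add: numeral_2_eq_2)
    then show "inv x = x" using x inv_equality by blast
  next
    assume "inv x = x"
    then have "x \<otimes> x = \<one>" using x r_inv by metis
    then have "x [^] (2::nat) = \<one>" using x by (simp add: numeral_2_eq_2)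
    then show "ord x \<le> 2" using pow_eq_id[OF x, of 2] by (simp add: dvd_imp_le)
  qed
  then show ?thesis unfolding ord_le_two_def by auto
qed

text \<open>A pair with two elements contains no self-inverse element, a singleton pair contains
  one, so every pair contributes 2 to the sum in \<open>cc\<close>. As the pairs partition the
  carrier, \<open>cc\<close> is the number of free binary choices in an inverse-closed set.\<close>

lemma card_inv_pairs:
  assumes fin: "finite (carrier G)"
  shows "real (card (inv_pair ` carrier G)) = cc G"
proof -
  let ?O = "inv_pair ` carrier G"
  let ?I = "{x \<in> carrier G. inv x = x}"
  have O1: "card o' + card (o' \<inter> ?I) = 2" if o': "o' \<in> ?O" for o'
  proof -
    obtain x where x: "x \<in> carrier G" "o' = inv_pair x" using o' by auto
    show ?thesis
    proof (cases "inv x = x")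
      case True
      then have "o' \<inter> ?I = {x}" "o' = {x}" using x by (auto simp: inv_pair_def)
      then show ?thesis by simp
    next
      case False
      then have "o' \<inter> ?I = {}" using x by (auto simp: inv_pair_def)
      then show ?thesis using False x by (simp add: inv_pair_def)
    qed
  qed
  have part: "\<Union> ?O = carrier G" by (auto simp: inv_pair_def)
  have disj: "o1 \<inter> o2 = {}" if "o1 \<in> ?O" "o2 \<in> ?O" "o1 \<noteq> o2" for o1 o2
    using that unfolding inv_pair_def by auto
  have fO: "finite ?O" "\<And>o'. o' \<in> ?O \<Longrightarrow> finite o'" using fin by (auto simp: inv_pair_def)
  have "card (carrier G) = (\<Sum>o'\<in>?O. card o')"
    using card_Union_disjoint[of ?O] part disj fO by (simp add: pairwise_def disjnt_def)
  moreover have "card ?I = (\<Sum>o'\<in>?O. card (o' \<inter> ?I))"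
  proof -
    have "?I = (\<Union>o'\<in>?O. o' \<inter> ?I)" using part by auto
    also have "card \<dots> = (\<Sum>o'\<in>?O. card (o' \<inter> ?I))"
      using disj fO by (intro card_UN_disjoint) blast+
    finally show ?thesis .
  qed
  ultimately have "card (carrier G) + card ?I = (\<Sum>o'\<in>?O. 2)"
    using O1 by (simp add: sum.distrib [symmetric])
  then have "real (card (carrier G)) + real (card ?I) = 2 * real (card ?O)" by simp
  then show ?thesis unfolding cc_def ord_le_two_eq[OF fin] order_def by simp
qed

definition moved :: "('a \<Rightarrow> 'a) \<Rightarrow> 'a set" where
  "moved h = {y \<in> carrier G. h y \<notin> inv_pair y}"

lemma set_inv_self_iff:
  assumes "S \<subseteq> carrier G" "S = set_inv S" "x \<in> carrier G"
  shows "inv x \<in> S \<longleftrightarrow> x \<in> S"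
proof -
  have "inv y \<in> S" if "y \<in> S" for y using assms that by (auto simp: SET_INV_def)
  then show ?thesis using assms(3) by (metis inv_inv)
qed

text \<open>Inverse-closed sets correspond to sets of inverse pairs, on which \<open>h\<close> acts
  as the partial map \<open>p\<close>, defined through a chosen moved representative
  \<open>s w\<close>. A pair holds at most two moved elements, so at least
  \<open>card (moved h) / 2\<close> pairs are displaced, each saving half a bit in
  \<open>card_invariant_subsets\<close>.\<close>

lemma card_invariant_inverse_closed:
  assumes fin: "finite (carrier G)" and h: "h \<in> carrier G \<rightarrow> carrier G"
  shows "real (card {S. S \<subseteq> carrier G \<and> S = set_inv S \<and> (\<forall>y\<in>carrier G. h y \<in> S \<longleftrightarrow> y \<in> S)})
           \<le> 2 powr (cc G - real (card (moved h)) / 4)"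
proof -
  let ?V = "inv_pair ` carrier G"
  let ?W = "inv_pair ` moved h"
  let ?F = "{S. S \<subseteq> carrier G \<and> S = set_inv S \<and> (\<forall>y\<in>carrier G. h y \<in> S \<longleftrightarrow> y \<in> S)}"
  define s where "s = (\<lambda>w. SOME y. y \<in> moved h \<and> inv_pair y = w)"
  define p where "p = (\<lambda>w. inv_pair (h (s w)))"
  have s: "s w \<in> moved h \<and> inv_pair (s w) = w" if "w \<in> ?W" for w
    unfolding s_def by (rule someI_ex) (use that in auto)
  have sc: "s w \<in> carrier G" "h (s w) \<in> carrier G" if "w \<in> ?W" for w
    using s[OF that] h by (auto simp: moved_def)
  let ?X = "{X. X \<subseteq> ?V \<and> (\<forall>v\<in>?W. v \<in> X \<longleftrightarrow> p v \<in> X)}"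
  have X: "(card ?X)\<^sup>2 * 2 ^ card ?W \<le> 4 ^ card ?V"
  proof (rule card_invariant_subsets)
    show "finite ?V" using fin by simp
    show "?W \<subseteq> ?V" by (auto simp: moved_def)
    fix w assume w: "w \<in> ?W"
    have "h (s w) \<notin> inv_pair (s w)" using s[OF w] unfolding moved_def by blast
    then have "p w \<noteq> inv_pair (s w)" unfolding p_def by (auto simp: inv_pair_def)
    then show "p w \<in> ?V \<and> p w \<noteq> w" using s[OF w] sc[OF w] by (auto simp: p_def)
  qed
  have fm: "finite (moved h)" using fin by (simp add: moved_def)
  have W: "card (moved h) \<le> 2 * card ?W"
  proof -
    have "moved h \<subseteq> \<Union> ?W" by (auto simp: inv_pair_def)
    then have "card (moved h) \<le> card (\<Union> ?W)"
      using fm by (intro card_mono) (auto simp: inv_pair_def)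
    also have "\<dots> \<le> (\<Sum>w\<in>?W. card w)" by (intro card_Union_le_sum_card)
    also have "\<dots> \<le> (\<Sum>w\<in>?W. 2)"
      by (intro sum_mono) (auto simp: inv_pair_def card_insert_if)
    finally show ?thesis by simp
  qed
  have "card ?F \<le> card ?X"
  proof (rule card_inj_on_le)
    show "inj_on (\<lambda>S. inv_pair ` S) ?F"
    proof (rule inj_onI)
      fix S S' assume S: "S \<in> ?F" "S' \<in> ?F" and eq: "inv_pair ` S = inv_pair ` S'"
      have U: "\<Union> (inv_pair ` A) = A" if "A \<in> ?F" for A
      proof -
        have "inv_pair x \<subseteq> A" if "x \<in> A" for x
          using \<open>A \<in> ?F\<close> that set_inv_self_iff[of A x] unfolding inv_pair_def by blast
        then show ?thesis unfolding inv_pair_def by blast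
      qed
      show "S = S'" using U[OF S(1)] U[OF S(2)] unfolding eq by simp
    qed
    show "(\<lambda>S. inv_pair ` S) ` ?F \<subseteq> ?X"
    proof (rule image_subsetI, rule CollectI, intro conjI ballI)
      fix S assume S: "S \<in> ?F"
      show "inv_pair ` S \<subseteq> ?V" using S by auto
      have mem: "inv_pair y \<in> inv_pair ` S \<longleftrightarrow> y \<in> S" if "y \<in> carrier G" for y
      proof
        assume "inv_pair y \<in> inv_pair ` S"
        then obtain z where z: "z \<in> S" "inv_pair y = inv_pair z" by auto
        then have "y = z \<or> y = inv z" by (auto simp: inv_pair_def doubleton_eq_iff)
        moreover have "inv z \<in> S" using S z set_inv_self_iff[of S z] by blast
        ultimately show "y \<in> S" using z by blast
      next
        assume "y \<in> S" then show "inv_pair y \<in> inv_pair ` S" by (rule imageI)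
      qed
      fix w assume w: "w \<in> ?W"
      show "w \<in> inv_pair ` S \<longleftrightarrow> p w \<in> inv_pair ` S"
      proof -
        have "h (s w) \<in> S \<longleftrightarrow> s w \<in> S" using S sc[OF w] by blast
        then show ?thesis
          using mem[OF sc(1)[OF w]] mem[OF sc(2)[OF w]] s[OF w] unfolding p_def by metis
      qed
    qed
    show "finite ?X" by (rule finite_subset[of _ "Pow ?V"]) (use fin in auto)
  qed
  then have "(card ?F)\<^sup>2 * 2 ^ card ?W \<le> 4 ^ card ?V"
    using X by (meson mult_le_mono1 order_trans power_mono zero_le)
  then have "real ((card ?F)\<^sup>2 * 2 ^ card ?W) \<le> real (4 ^ card ?V)" by (rule of_nat_mono)
  then have "(real (card ?F))\<^sup>2 * 2 powr card ?W \<le> 4 ^ card ?V"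
    by (simp add: powr_realpow)
  also have "(4::real) ^ card ?V = 2 powr (2 * cc G)"
    unfolding card_inv_pairs[OF fin, symmetric]
    by (simp add: powr_realpow[symmetric] powr_powr[symmetric])
  finally have "(real (card ?F))\<^sup>2 \<le> 2 powr (2 * cc G) / 2 powr card ?W"
    by (simp add: field_simps)
  also have "\<dots> = 2 powr (2 * cc G - card ?W)" by (simp add: powr_diff)
  also have "\<dots> \<le> 2 powr (2 * (cc G - real (card (moved h)) / 4))" using W by simp
  also have "\<dots> = (2 powr (cc G - real (card (moved h)) / 4))\<^sup>2"
    by (metis mult.commute mult_2 power2_eq_square powr_add)
  finally show ?thesis by (rule power2_le_imp_le) simp
qed

end


section \<open>Subgroups inverted by their complement\<close>

context group
begin

lemma inj_on_left_mult: "x \<in> carrier G \<Longrightarrow> B \<subseteq> carrier G \<Longrightarrow> inj_on (\<lambda>y. x \<otimes> y) B"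
  using inj_on_cmult inj_on_subset by blast

lemma inv_mult_cancel:
  "x \<in> carrier G \<Longrightarrow> y \<in> carrier G \<Longrightarrow> inv x \<otimes> (x \<otimes> y) = y"
  "x \<in> carrier G \<Longrightarrow> y \<in> carrier G \<Longrightarrow> x \<otimes> (inv x \<otimes> y) = y"
  by (simp_all add: m_assoc[symmetric])

lemmas group_norm = m_assoc inv_mult_group inv_mult_cancel

lemma right_inverse_eq:
  assumes "x \<in> carrier G" "y \<in> carrier G" "\<one> = x \<otimes> y"
  shows "y = inv x"
proof -
  have "inv x \<otimes> (x \<otimes> y) = inv x" using assms by (metis inv_closed r_one)
  then show ?thesis using assms by (simp add: inv_mult_cancel)
qed

lemma proper_subgroup_card:
  assumes "finite (carrier G)" "subgroup K G" "subgroup H G" "K \<subset> H"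
  shows "2 * card K \<le> card H"
proof -
  have HC: "H \<subseteq> carrier G" and KC: "K \<subseteq> carrier G"
    using assms subgroup.subset by auto
  then have fH: "finite H" using assms finite_subset by blast
  obtain h where h: "h \<in> H" "h \<notin> K" using assms by auto
  let ?K' = "(\<lambda>k. h \<otimes> k) ` K"
  have "inj_on (\<lambda>k. h \<otimes> k) K"
    using h HC KC by (intro inj_on_left_mult) auto
  then have c: "card ?K' = card K" by (rule card_image)
  have "?K' \<subseteq> H" using assms h by (auto intro: subgroup.m_closed)
  moreover have "K \<inter> ?K' = {}"
  proof -
    have "h \<in> K" if "h \<otimes> k \<in> K" "k \<in> K" for k
    proof -
      have "(h \<otimes> k) \<otimes> inv k \<in> K"
        using that assms(2) by (simp add: subgroup.m_closed subgroup.m_inv_closed)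
      then show ?thesis using that h HC KC by (simp add: m_assoc subsetD)
    qed
    then show ?thesis using h by blast
  qed
  ultimately have "card K + card ?K' \<le> card H"
    using fH assms(4) by (metis Un_subset_iff card_Un_disjoint card_mono finite_subset psubset_imp_subset)
  then show ?thesis using c by simp
qed

text \<open>Left cosets are disjoint or equal, and \<open>H\<close> with two further cosets would
  need \<open>3 * card H\<close> elements. So only one coset besides \<open>H\<close> exists,
  represented by any \<open>u\<close> in it.\<close>

lemma large_subgroup_complement:
  assumes fin: "finite (carrier G)" and H: "subgroup H G"
    and big: "card (carrier G) < 3 * card H" and u: "u \<in> carrier G - H"
  shows "carrier G - H = (\<lambda>h. u \<otimes> h) ` H"
proof -
  have HC: "H \<subseteq> carrier G" using H subgroup.subset by auto
  have fH: "finite H" using HC fin finite_subset by blast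
  let ?T = "\<lambda>w. (\<lambda>h. w \<otimes> h) ` H"
  have card: "card (?T w) = card H" if "w \<in> carrier G" for w
    using that HC by (intro card_image inj_on_left_mult)
  have sub: "?T w \<subseteq> carrier G" if "w \<in> carrier G" for w using that HC by auto
  have coset: "inv w \<otimes> x \<in> H" if "x \<in> ?T w" "w \<in> carrier G" for w x
    using that HC by (auto simp: group_norm subsetD)
  have quot: "w \<in> ?T x" if "inv x \<otimes> w \<in> H" "w \<in> carrier G" "x \<in> carrier G" for w x
    by (rule image_eqI[OF _ that(1)]) (use that in \<open>simp add: m_assoc[symmetric]\<close>)
  have disj: "w' \<in> ?T w" if "?T w \<inter> ?T w' \<noteq> {}" "w \<in> carrier G" "w' \<in> carrier G" for w w'
  proof -
    obtain x where x: "x \<in> ?T w" "x \<in> ?T w'" using \<open>?T w \<inter> ?T w' \<noteq> {}\<close> by auto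
    then have xc: "x \<in> carrier G" using sub that by blast
    have "inv w \<otimes> x \<in> H" "inv w' \<otimes> x \<in> H" using coset x that by auto
    then have "inv w \<otimes> x \<otimes> inv (inv w' \<otimes> x) \<in> H"
      using H by (simp add: subgroup.m_closed subgroup.m_inv_closed)
    also have "inv w \<otimes> x \<otimes> inv (inv w' \<otimes> x) = inv w \<otimes> w'"
      using that xc by (simp add: group_norm)
    finally show ?thesis using quot that by blast
  qed
  have one: "?T \<one> = H" using HC by (auto simp: subsetD intro!: image_eqI)
  have uc: "u \<in> carrier G" using u by simp
  have "w \<in> ?T u" if w: "w \<in> carrier G - H" for w
  proof (rule ccontr)
    assume n: "w \<notin> ?T u"
    have wc: "w \<in> carrier G" using w by simp
    have d: "H \<inter> ?T u = {}" "H \<inter> ?T w = {}" "?T u \<inter> ?T w = {}"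
      using disj[of \<one> u, unfolded one] disj[of \<one> w, unfolded one] disj[of u w] u w uc wc n
      by blast+
    have "card (H \<union> ?T u \<union> ?T w) = card H + card H + card H"
      using d fH card[OF uc] card[OF wc] by (subst card_Un_disjoint) (auto simp: card_Un_disjoint)
    moreover have "card (H \<union> ?T u \<union> ?T w) \<le> card (carrier G)"
      using HC sub[OF uc] sub[OF wc] fin by (intro card_mono) auto
    ultimately show False using big by simp
  qed
  moreover have "?T u \<subseteq> carrier G - H"
  proof -
    have "H \<inter> ?T u = {}"
      using disj[of \<one> u, unfolded one] u uc by blast
    then show ?thesis using sub[OF uc] by blast
  qed
  ultimately show ?thesis by blast
qed

lemma subgroup_commutant:
  assumes "subgroup H G" "t \<in> carrier G"
  shows "subgroup {c \<in> H. c \<otimes> t = t \<otimes> c} G"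
proof (rule subgroupI)
  have HC: "H \<subseteq> carrier G" using assms subgroup.subset by auto
  then show "{c \<in> H. c \<otimes> t = t \<otimes> c} \<subseteq> carrier G" by auto
  show "{c \<in> H. c \<otimes> t = t \<otimes> c} \<noteq> {}"
    using assms subgroup.one_closed by force
  fix a assume a: "a \<in> {c \<in> H. c \<otimes> t = t \<otimes> c}"
  then have ac: "a \<in> carrier G" using HC by auto
  have "inv a \<otimes> t = inv a \<otimes> (t \<otimes> a) \<otimes> inv a" using ac assms by (simp add: m_assoc)
  also have "t \<otimes> a = a \<otimes> t" using a by simp
  also have "inv a \<otimes> (a \<otimes> t) \<otimes> inv a = t \<otimes> inv a" using ac assms by (simp add: group_norm)
  finally show "inv a \<in> {c \<in> H. c \<otimes> t = t \<otimes> c}"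
    using a assms(1) by (simp add: subgroup.m_inv_closed)
  fix b assume b: "b \<in> {c \<in> H. c \<otimes> t = t \<otimes> c}"
  then have bc: "b \<in> carrier G" using HC by auto
  have "a \<otimes> b \<otimes> t = a \<otimes> (b \<otimes> t)" using ac bc assms by (simp add: m_assoc)
  also have "\<dots> = a \<otimes> t \<otimes> b" using b ac bc assms by (simp add: m_assoc)
  also have "\<dots> = t \<otimes> (a \<otimes> b)" using a ac bc assms by (simp add: m_assoc)
  finally have "a \<otimes> b \<otimes> t = t \<otimes> (a \<otimes> b)" .
  then show "a \<otimes> b \<in> {c \<in> H. c \<otimes> t = t \<otimes> c}"
    using a b assms(1) by (simp add: subgroup.m_closed)
qed

text \<open>The internal form of a generalised dicyclic group with abelian subgroup \<open>H\<close>.\<close>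

definition inverted_half :: "'a set \<Rightarrow> bool" where
  "inverted_half H \<longleftrightarrow>
     subgroup H G \<and> (\<forall>a\<in>H. \<forall>b\<in>H. a \<otimes> b = b \<otimes> a) \<and> (\<exists>v\<in>H. v \<otimes> v \<noteq> \<one>) \<and>
     (\<exists>x\<in>carrier G - H. x \<otimes> x \<noteq> \<one> \<and> carrier G - H = (\<lambda>h. x \<otimes> h) ` H \<and>
        (\<forall>h\<in>H. x \<otimes> h = inv h \<otimes> x))"

text \<open>\<open>D\<close> is a small set of exceptions. The set \<open>J t\<close> of elements
  outside \<open>H\<close> that invert \<open>t\<close> misses few elements of the complement, and a
  quotient \<open>inv u \<otimes> y\<close> of two of its members commutes with \<open>t\<close>.
  For \<open>v\<close> this puts a translate of \<open>J v\<close> into the centraliser of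
  \<open>v\<close>, which is disjoint from \<open>J v\<close>; hence \<open>J v\<close> fills at
  most half of the group and \<open>H\<close> has index 2. Then the centraliser of any
  \<open>t\<close> in \<open>H\<close> has more than half the elements of \<open>H\<close>, so it is
  all of \<open>H\<close>.\<close>

lemma inverted_halfI:
  assumes fin: "finite (carrier G)" and H: "subgroup H G" "H \<noteq> carrier G"
    and D: "D \<subseteq> carrier G" "12 * card D < card (carrier G)"
    and v: "v \<in> H" "v \<otimes> v \<noteq> \<one>"
    and inverts: "\<And>t y. \<lbrakk>t \<in> H; y \<in> carrier G; y \<notin> H; y \<notin> D; t \<otimes> y \<notin> D\<rbrakk> \<Longrightarrow> y \<otimes> t = inv t \<otimes> y"
    and nsq: "\<And>y. \<lbrakk>y \<in> carrier G; y \<notin> H; y \<notin> D\<rbrakk> \<Longrightarrow> y \<otimes> y \<noteq> \<one>"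
  shows "inverted_half H"
proof -
  let ?n = "card (carrier G)"
  have HC: "H \<subseteq> carrier G" using H subgroup.subset by auto
  have fH: "finite H" using HC fin finite_subset by blast
  have fD: "finite D" using D fin finite_subset by blast
  define J where "J = (\<lambda>t. {y \<in> carrier G - H. y \<otimes> t = inv t \<otimes> y})"
  have fJ: "finite (J t)" for t using fin by (simp add: J_def)
  have JC: "J t \<subseteq> carrier G - H" for t by (auto simp: J_def)
  have bigJ: "?n \<le> card H + card (J t) + 2 * card D" if t: "t \<in> H" for t
  proof -
    let ?E = "{y \<in> carrier G. t \<otimes> y \<in> D}"
    have "card ?E \<le> card D"
    proof (rule card_inj_on_le)
      show "inj_on (\<lambda>y. t \<otimes> y) ?E" using t HC by (intro inj_on_left_mult) auto
    qed (use fD in auto)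
    moreover have "carrier G \<subseteq> H \<union> J t \<union> D \<union> ?E" using inverts[OF t] by (auto simp: J_def)
    then have "?n \<le> card (H \<union> J t \<union> D \<union> ?E)" using fH fJ fD fin by (intro card_mono) auto
    then have "?n \<le> card H + card (J t) + card D + card ?E"
      by (meson add_le_mono1 card_Un_le order_trans)
    ultimately show ?thesis by simp
  qed
  have trans: "(inv u \<otimes> y) \<otimes> t = t \<otimes> (inv u \<otimes> y)" if "u \<in> J t" "y \<in> J t" "t \<in> H" for u y t
  proof -
    have c: "u \<in> carrier G" "y \<in> carrier G" "t \<in> carrier G" using that HC by (auto simp: J_def)
    have u: "u \<otimes> t = inv t \<otimes> u" and y: "y \<otimes> t = inv t \<otimes> y" using that by (auto simp: J_def)
    have "u \<otimes> (t \<otimes> (inv u \<otimes> y)) = (u \<otimes> t) \<otimes> (inv u \<otimes> y)" using c by (simp add: m_assoc)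
    also have "\<dots> = inv t \<otimes> y" unfolding u using c by (simp add: group_norm)
    also have "\<dots> = y \<otimes> t" using y by simp
    finally have "inv u \<otimes> (u \<otimes> (t \<otimes> (inv u \<otimes> y))) = inv u \<otimes> (y \<otimes> t)" by simp
    then show ?thesis using c by (simp add: group_norm)
  qed
  have inj: "inj_on (\<lambda>y. inv u \<otimes> y) B" if "u \<in> carrier G" "B \<subseteq> carrier G" for u B
    using that by (intro inj_on_left_mult) auto
  have "2 * card (J v) \<le> ?n"
  proof (cases "J v = {}")
    case False
    then obtain u where u: "u \<in> J v" by auto
    let ?C = "{c \<in> carrier G. c \<otimes> v = v \<otimes> c}"
    have uC: "u \<in> carrier G" using u by (auto simp: J_def)
    have "card (J v) \<le> card ?C"
    proof (rule card_inj_on_le[OF inj[OF uC]])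
      show "(\<lambda>y. inv u \<otimes> y) ` J v \<subseteq> ?C" using trans[OF u] v uC JC by fastforce
    qed (use JC fin in auto)
    moreover have "J v \<inter> ?C = {}"
    proof -
      have "v \<otimes> v = \<one>" if "y \<in> J v" "y \<in> ?C" for y
      proof -
        have c: "y \<in> carrier G" "v \<in> carrier G" using that v HC by auto
        have "v \<otimes> y = inv v \<otimes> y" using that by (simp add: J_def)
        then show ?thesis using c by (metis inv_closed right_cancel r_inv)
      qed
      then show ?thesis using v by blast
    qed
    then have "card (J v) + card ?C \<le> ?n"
      using fin fJ JC by (subst card_Un_disjoint[symmetric]) (auto intro!: card_mono)
    ultimately show ?thesis by simp
  qed simp
  \<comment> \<open>As \<open>2 * card D < ?n / 6\<close>, what remains for \<open>H\<close> is more
    than \<open>?n - ?n / 2 - ?n / 6 = ?n / 3\<close>.\<close>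
  then have big: "?n < 3 * card H" using bigJ[OF v(1)] D by linarith
  obtain w where w: "w \<in> carrier G - H" using H HC by blast
  have comp: "carrier G - H = (\<lambda>h. u \<otimes> h) ` H" if "u \<in> carrier G - H" for u
    using large_subgroup_complement[OF fin H(1) big that] .
  have "card ((\<lambda>h. w \<otimes> h) ` H) = card H"
    using w HC by (intro card_image inj_on_left_mult) auto
  then have n2: "?n = 2 * card H"
    using comp[OF w] HC fin fH by (metis card_Diff_subset card_mono le_add_diff_inverse mult_2)
  have key: "(\<forall>h\<in>H. h \<otimes> t = t \<otimes> h) \<and> (\<forall>u\<in>carrier G - H. u \<otimes> t = inv t \<otimes> u)" if t: "t \<in> H" for t
  proof -
    have tc: "t \<in> carrier G" using t HC by auto
    have Jt: "2 * card (J t) > card H" using bigJ[OF t] n2 D by linarith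
    then obtain u0 where u0: "u0 \<in> J t" by fastforce
    have u0c: "u0 \<in> carrier G - H" using u0 JC by auto
    let ?K = "{c \<in> H. c \<otimes> t = t \<otimes> c}"
    have "card (J t) \<le> card ?K"
    proof (rule card_inj_on_le[OF inj])
      show "(\<lambda>y. inv u0 \<otimes> y) ` J t \<subseteq> ?K"
      proof (rule image_subsetI)
        fix y assume y: "y \<in> J t"
        then obtain h where "h \<in> H" "y = u0 \<otimes> h" using comp[OF u0c] JC by blast
        then have "inv u0 \<otimes> y \<in> H" using u0c HC by (simp add: group_norm subsetD)
        then show "inv u0 \<otimes> y \<in> ?K" using trans[OF u0 y t] by simp
      qed
    qed (use u0c JC fH in auto)
    then have "\<not> 2 * card ?K \<le> card H" using Jt by simp
    then have "\<not> ?K \<subset> H"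
      using proper_subgroup_card[OF fin subgroup_commutant[OF H(1) tc] H(1)] by blast
    then have K: "\<forall>h\<in>H. h \<otimes> t = t \<otimes> h" by blast
    \<comment> \<open>Since \<open>t\<close> commutes with all of \<open>H\<close>, the whole coset
      of \<open>u0\<close> inverts \<open>t\<close> as \<open>u0\<close> does.\<close>
    have "u \<otimes> t = inv t \<otimes> u" if "u \<in> carrier G - H" for u
    proof -
      obtain h where h: "h \<in> H" "u = u0 \<otimes> h" using comp[OF u0c] \<open>u \<in> carrier G - H\<close> by blast
      have "u \<otimes> t = u0 \<otimes> t \<otimes> h" using h K u0c HC tc by (simp add: m_assoc subsetD)
      also have "\<dots> = inv t \<otimes> u" using h u0 HC tc by (simp add: J_def m_assoc subsetD)
      finally show ?thesis .
    qed
    then show ?thesis using K by blast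
  qed
  have "\<not> carrier G - H \<subseteq> D"
  proof
    assume "carrier G - H \<subseteq> D"
    then have "card (carrier G - H) \<le> card D" using fD card_mono by blast
    then show False using n2 D HC fH by (simp add: card_Diff_subset)
  qed
  then obtain x where x: "x \<in> carrier G - H" "x \<notin> D" by blast
  show ?thesis
    unfolding inverted_half_def
    using H(1) key v x nsq[of x] comp[OF x(1)] by blast
qed

end


section \<open>Families of permutations closed under shifts\<close>

text \<open>These are the properties of a point stabiliser in a permutation group that contains all
  right multiplications: the shift of \<open>g\<close> by \<open>r\<close> is right multiplication
  by \<open>r\<close>, then \<open>g\<close>, then right multiplication by \<open>inv (g r)\<close>,
  and it fixes the identity again.\<close>

locale stabiliser_family = group G for G (structure) +
  fixes A :: "('a \<Rightarrow> 'a) set"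
  assumes fin: "finite (carrier G)"
    and Bij: "\<And>g. g \<in> A \<Longrightarrow> g \<in> Bij (carrier G)"
    and fix_one: "\<And>g. g \<in> A \<Longrightarrow> g \<one> = \<one>"
    and comp: "\<And>f g. f \<in> A \<Longrightarrow> g \<in> A \<Longrightarrow> compose (carrier G) f g \<in> A"
    and inverse: "\<And>g. g \<in> A \<Longrightarrow> \<exists>f\<in>A. \<forall>x\<in>carrier G. f (g x) = x"
    and shift: "\<And>g r. g \<in> A \<Longrightarrow> r \<in> carrier G \<Longrightarrow>
      (\<lambda>y\<in>carrier G. g (y \<otimes> r) \<otimes> inv (g r)) \<in> A"
begin

definition fixed where "fixed = {y \<in> carrier G. \<forall>g\<in>A. g y = y}"

definition stray where "stray = {y \<in> carrier G. \<exists>g\<in>A. g y \<notin> inv_pair y}"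

lemma closed [simp]: "g \<in> A \<Longrightarrow> y \<in> carrier G \<Longrightarrow> g y \<in> carrier G"
  using Bij_imp_funcset[OF Bij] by auto

text \<open>The shift of \<open>g\<close> by \<open>r\<close> lies in \<open>A\<close>, so it fixes
  \<open>t\<close>; unfolding the shift gives the equation. \<open>nonstray_shift\<close> unfolds
  the same shift at a point that can only move within its inverse pair.\<close>

lemma fixed_shift:
  assumes "g \<in> A" "t \<in> fixed" "r \<in> carrier G"
  shows "g (t \<otimes> r) = t \<otimes> g r"
proof -
  have t: "t \<in> carrier G" using assms by (simp add: fixed_def)
  have "(\<lambda>y\<in>carrier G. g (y \<otimes> r) \<otimes> inv (g r)) t = t"
    using shift[OF assms(1,3)] assms(2) unfolding fixed_def by blast
  then have "g (t \<otimes> r) \<otimes> inv (g r) = t" using t by simp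
  then show ?thesis using assms t by (simp add: inv_solve_right')
qed

lemma nonstray_shift:
  assumes "g \<in> A" "y \<in> carrier G" "y \<notin> stray" "r \<in> carrier G"
  shows "g (y \<otimes> r) = y \<otimes> g r \<or> g (y \<otimes> r) = inv y \<otimes> g r"
proof -
  have "(\<lambda>y\<in>carrier G. g (y \<otimes> r) \<otimes> inv (g r)) y \<in> inv_pair y"
    using shift[OF assms(1,4)] assms(2,3) by (auto simp: stray_def)
  then have "g (y \<otimes> r) \<otimes> inv (g r) = y \<or> g (y \<otimes> r) \<otimes> inv (g r) = inv y"
    using assms(2) by (simp add: inv_pair_def)
  then show ?thesis using assms by (simp add: inv_solve_right')
qed

lemma inv_nonstray:
  assumes "y \<in> carrier G" "y \<notin> stray"
  shows "inv y \<notin> stray"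
proof -
  have "g (inv y) \<in> inv_pair (inv y)" if g: "g \<in> A" for g
  proof -
    \<comment> \<open>For \<open>r = inv y\<close> the product \<open>y \<otimes> r\<close> is the
      identity, which \<open>g\<close> fixes.\<close>
    have "\<one> = y \<otimes> g (inv y) \<or> \<one> = inv y \<otimes> g (inv y)"
      using nonstray_shift[OF g assms, of "inv y"] assms fix_one[OF g] by simp
    then have "g (inv y) = inv y \<or> g (inv y) = y"
      using assms(1) closed[OF g, of "inv y"] right_inverse_eq[of y] right_inverse_eq[of "inv y"]
        inv_closed inv_inv by metis
    then show ?thesis using assms by (auto simp: inv_pair_def)
  qed
  then show ?thesis by (auto simp: stray_def)
qed

lemma inv_fixed:
  assumes "y \<in> fixed"
  shows "inv y \<in> fixed"
proof -
  have y: "y \<in> carrier G" using assms by (simp add: fixed_def)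
  have "g (inv y) = inv y" if g: "g \<in> A" for g
  proof -
    have "\<one> = y \<otimes> g (inv y)" using fixed_shift[OF g assms, of "inv y"] y fix_one[OF g] by simp
    then show ?thesis by (rule right_inverse_eq[OF y closed[OF g inv_closed[OF y]]])
  qed
  then show ?thesis using y by (auto simp: fixed_def)
qed

lemma subgroup_fixed: "subgroup fixed G"
proof (rule subgroupI)
  show "fixed \<noteq> {}" using fix_one one_closed unfolding fixed_def by blast
  show "a \<otimes> b \<in> fixed" if a: "a \<in> fixed" and b: "b \<in> fixed" for a b
  proof -
    have c: "a \<in> carrier G" "b \<in> carrier G" using a b by (auto simp: fixed_def)
    have "g (a \<otimes> b) = a \<otimes> b" if "g \<in> A" for g
    proof -
      have "g b = b" using b that unfolding fixed_def by blast
      then show ?thesis using fixed_shift[OF that a c(2)] by simp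
    qed
    then show ?thesis using c by (simp add: fixed_def)
  qed
  show "inv a \<in> fixed" if "a \<in> fixed" for a using inv_fixed[OF that] .
qed (simp add: fixed_def)

lemma flipped:
  assumes "y \<in> carrier G" "y \<notin> fixed" "y \<notin> stray"
  obtains g where "g \<in> A" "g y = inv y" "inv y \<noteq> y"
  using assms by (auto simp: fixed_def stray_def inv_pair_def)

text \<open>A member \<open>g\<close> that flips \<open>y\<close> sends \<open>t \<otimes> y\<close>
  to \<open>t \<otimes> inv y\<close>. This must be \<open>t \<otimes> y\<close> or its inverse; the
  former would give \<open>inv y = y\<close>, so \<open>t \<otimes> inv y\<close> equals
  \<open>inv (t \<otimes> y)\<close>.\<close>

lemma fixed_inverted:
  assumes "t \<in> fixed" "y \<in> carrier G" "y \<notin> fixed" "y \<notin> stray" "t \<otimes> y \<notin> stray"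
  shows "y \<otimes> t = inv t \<otimes> y"
proof -
  obtain g where g: "g \<in> A" "g y = inv y" "inv y \<noteq> y" using flipped assms by metis
  have t: "t \<in> carrier G" using assms by (simp add: fixed_def)
  have e: "g (t \<otimes> y) = t \<otimes> inv y" using fixed_shift[OF g(1) assms(1,2)] g by simp
  have "g (t \<otimes> y) \<in> inv_pair (t \<otimes> y)"
    using g(1) assms(5) m_closed[OF t assms(2)] unfolding stray_def by blast
  then have "t \<otimes> inv y = t \<otimes> y \<or> t \<otimes> inv y = inv y \<otimes> inv t"
    using e t assms by (simp add: inv_pair_def inv_mult_group)
  then have "t \<otimes> inv y = inv y \<otimes> inv t" using g t assms by simp
  then have "y \<otimes> (t \<otimes> inv y) \<otimes> y = y \<otimes> (inv y \<otimes> inv t) \<otimes> y" by simp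
  then show ?thesis using t assms by (simp add: group_norm)
qed

text \<open>The four cases come from comparing the two values each of \<open>g v\<close> and of \<open>g ((v y\<inverse>) y)\<close>.\<close>

lemma flipped_relation:
  assumes y: "y \<in> carrier G" "y \<notin> fixed" "y \<notin> stray"
    and v: "v \<in> carrier G" "v \<notin> stray" "v \<otimes> inv y \<notin> stray"
  shows "v \<otimes> y = y \<otimes> v \<or> v \<otimes> y = y \<otimes> inv v \<or> v \<otimes> v = y \<otimes> y"
proof -
  obtain g where g: "g \<in> A" "g y = inv y" "inv y \<noteq> y" using flipped y by metis
  have "g v = v \<or> g v = inv v" using v g by (auto simp: stray_def inv_pair_def)
  moreover have "g v = v \<otimes> inv y \<otimes> inv y \<or> g v = y \<otimes> inv v \<otimes> inv y"
    using nonstray_shift[OF g(1) _ v(3) y(1)] v y g by (simp add: group_norm)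
  moreover have False if "v = v \<otimes> inv y \<otimes> inv y"
  proof -
    have "inv v \<otimes> v \<otimes> y = inv v \<otimes> (v \<otimes> inv y \<otimes> inv y) \<otimes> y" using that by simp
    then show False using v y g by (simp add: group_norm)
  qed
  moreover have "v \<otimes> y = y \<otimes> inv v" if "v = y \<otimes> inv v \<otimes> inv y"
  proof -
    have "v \<otimes> y = y \<otimes> inv v \<otimes> inv y \<otimes> y" using that by simp
    then show ?thesis using v y by (simp add: group_norm)
  qed
  moreover have "v \<otimes> v = y \<otimes> y" if "inv v = v \<otimes> inv y \<otimes> inv y"
  proof -
    have "v \<otimes> inv v \<otimes> (y \<otimes> y) = v \<otimes> (v \<otimes> inv y \<otimes> inv y) \<otimes> (y \<otimes> y)" using that by simp
    then show ?thesis using v y by (simp add: group_norm)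
  qed
  moreover have "v \<otimes> y = y \<otimes> v" if "inv v = y \<otimes> inv v \<otimes> inv y"
  proof -
    have "v \<otimes> inv v \<otimes> (y \<otimes> v) = v \<otimes> (y \<otimes> inv v \<otimes> inv y) \<otimes> (y \<otimes> v)" using that by simp
    then show ?thesis using v y by (simp add: group_norm)
  qed
  ultimately show ?thesis by metis
qed

text \<open>The alternative \<open>z \<otimes> z = y \<otimes> y\<close> left open by
  \<open>flipped_relation\<close> is excluded by applying that lemma also to
  \<open>u = z \<otimes> y\<close>. Were both claims false,
  \<open>u \<otimes> y = y \<otimes> inv u\<close> would follow, so that the square of
  \<open>y\<close> equals both the square of \<open>z\<close> and its inverse.\<close>

lemma flipped_commutes_or_inverts:
  assumes invol: "\<And>t. t \<in> fixed \<Longrightarrow> t \<otimes> t = \<one>"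
    and y: "y \<in> carrier G" "y \<notin> fixed" "y \<notin> stray"
    and z: "z \<in> carrier G" "z \<notin> stray" "z \<otimes> inv y \<notin> stray" "z \<otimes> y \<notin> stray"
  shows "z \<otimes> y = y \<otimes> z \<or> z \<otimes> y = y \<otimes> inv z"
proof (rule ccontr)
  assume "\<not> ?thesis"
  then have nc: "z \<otimes> y \<noteq> y \<otimes> z" and ni: "z \<otimes> y \<noteq> y \<otimes> inv z" by auto
  have sq: "z \<otimes> z = y \<otimes> y" using flipped_relation[OF y z(1-3)] nc ni by auto
  define u where "u = z \<otimes> y"
  have uc: "u \<in> carrier G" using y z by (simp add: u_def)
  have uy: "u \<otimes> inv y = z" using y z by (simp add: u_def group_norm)
  have nuc: "u \<otimes> y \<noteq> y \<otimes> u"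
  proof
    assume "u \<otimes> y = y \<otimes> u"
    then have "u \<otimes> y \<otimes> inv y = y \<otimes> u \<otimes> inv y" by simp
    then show False using nc y z by (simp add: u_def group_norm)
  qed
  have nusq: "u \<otimes> u \<noteq> y \<otimes> y"
  proof
    assume "u \<otimes> u = y \<otimes> y"
    then have "u \<otimes> u \<otimes> (inv y \<otimes> inv z) = y \<otimes> y \<otimes> (inv y \<otimes> inv z)" by simp
    then show False using ni y z by (simp add: u_def group_norm)
  qed
  have "u \<otimes> y = y \<otimes> inv u"
    using flipped_relation[OF y uc] nuc nusq z uy u_def by auto
  then have "inv z \<otimes> (u \<otimes> y) = inv z \<otimes> (y \<otimes> inv u)" by simp
  then have sq': "y \<otimes> y = inv z \<otimes> inv z" using y z by (simp add: u_def group_norm)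
  \<comment> \<open>If \<open>u\<close> is fixed, it is its own inverse and inverted by
    \<open>inv y\<close>, so it commutes with \<open>y\<close>. Otherwise some member flips
    \<open>u\<close>, and \<open>flipped_relation\<close> applies with \<open>u\<close> as the
    flipped element.\<close>
  show False
  proof (cases "u \<in> fixed")
    case True
    have iy: "inv y \<in> carrier G" "inv y \<notin> fixed" "inv y \<notin> stray"
      using y inv_fixed[of "inv y"] inv_nonstray[of y] by auto
    have "inv y \<otimes> u = inv u \<otimes> inv y"
      using fixed_inverted[OF True iy] uy z by simp
    also have "inv u = u" using invol[OF True] uc inv_equality by blast
    finally have "y \<otimes> (inv y \<otimes> u) \<otimes> y = y \<otimes> (u \<otimes> inv y) \<otimes> y" by simp
    then show False using nuc y uc by (simp add: group_norm)
  next
    case False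
    have "y \<otimes> inv u = inv z" using y z by (simp add: u_def group_norm)
    then have "y \<otimes> u = u \<otimes> y \<or> y \<otimes> u = u \<otimes> inv y \<or> y \<otimes> y = u \<otimes> u"
      using flipped_relation[of u y] uc False y z inv_nonstray[OF z(1,2)] by (simp add: u_def)
    then have "y \<otimes> u = z" using nuc nusq uy by auto
    \<comment> \<open>From \<open>z = y \<otimes> (z \<otimes> y)\<close> comes
      \<open>z \<otimes> y = inv y \<otimes> z\<close>. As \<open>y\<close> and \<open>z\<close>
      have the same square, this is \<open>y \<otimes> inv z\<close>, the excluded case.\<close>
    then have "z = y \<otimes> (z \<otimes> y)" by (simp add: u_def)
    then have "inv y \<otimes> z \<otimes> (inv z \<otimes> inv z) = inv y \<otimes> (y \<otimes> (z \<otimes> y)) \<otimes> (inv z \<otimes> inv z)" by simp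
    then have "inv y \<otimes> inv z = z \<otimes> y \<otimes> (inv z \<otimes> inv z)" using y z by (simp add: group_norm)
    also have "\<dots> = z \<otimes> y \<otimes> (y \<otimes> y)" using sq' by simp
    finally have 1: "inv y \<otimes> inv z = z \<otimes> y \<otimes> (y \<otimes> y)" .
    have c4: "y \<otimes> y \<otimes> (y \<otimes> y) = \<one>" using sq sq' z by (metis group_norm(1) inv_closed inv_mult_group m_closed r_inv)
    have "z \<otimes> y = inv y \<otimes> inv z \<otimes> (inv (y \<otimes> y))" using 1 y z by (simp add: group_norm)
    also have "inv (y \<otimes> y) = z \<otimes> z" using sq' z y by (simp add: inv_mult_group)
    finally have "z \<otimes> y = inv y \<otimes> z" using z y by (simp add: group_norm)
    also have "inv y = y \<otimes> (inv y \<otimes> inv y)" using y by (simp add: group_norm)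
    also have "inv y \<otimes> inv y = inv z \<otimes> inv z" using sq y z by (simp add: inv_mult_group[symmetric])
    finally show False using ni y z by (simp add: group_norm)
  qed
qed

text \<open>Suppose \<open>stray\<close> has fewer than \<open>n / 36\<close> elements,
  \<open>n\<close> being the group order. If some fixed \<open>t\<close> is not its own inverse,
  \<open>fixed\<close> is an \<open>inverted_half\<close>. Otherwise every \<open>y\<close> in
  \<open>?I\<close> is central, since the centraliser of a non-central one would be an
  \<open>inverted_half\<close>. But \<open>?I\<close> has more than \<open>n / 3\<close> elements,
  too many for the centre of a non-abelian group, and in an abelian group any element of
  \<open>?I\<close> contradicts \<open>no_abelian\<close>, its square not being the
  identity.\<close>

lemma order_le_stray:
  assumes moving: "\<exists>g\<in>A. \<exists>y\<in>carrier G. g y \<noteq> y"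
    and no_half: "\<And>H. \<not> inverted_half H"
    and no_abelian: "\<not> (comm_group G \<and> (\<exists>y\<in>carrier G. y \<otimes> y \<noteq> \<one>))"
  shows "card (carrier G) \<le> 36 * card stray"
proof (rule ccontr)
  assume "\<not> ?thesis"
  then have small: "36 * card stray < card (carrier G)" by simp
  have DC: "stray \<subseteq> carrier G" by (auto simp: stray_def)
  then have fD: "finite stray" using fin finite_subset by blast
  have proper: "fixed \<noteq> carrier G" using moving by (auto simp: fixed_def)
  have sq: "y \<otimes> y \<noteq> \<one>" if "y \<in> carrier G" "y \<notin> fixed" "y \<notin> stray" for y
    using flipped[OF that] that inv_equality by metis
  have invol: "t \<otimes> t = \<one>" if "t \<in> fixed" for t
  proof (rule ccontr)
    assume "t \<otimes> t \<noteq> \<one>"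
    then have "inverted_half fixed"
      using subgroup_fixed proper DC small that sq fixed_inverted fin
      by (intro inverted_halfI[where D = stray and v = t]) auto
    then show False using no_half by blast
  qed
  let ?I = "carrier G - fixed - stray"
  have central: "y \<otimes> z = z \<otimes> y" if y: "y \<in> ?I" and z: "z \<in> carrier G" for y z
  proof (rule ccontr)
    assume nc: "y \<otimes> z \<noteq> z \<otimes> y"
    have yc: "y \<in> carrier G" using y by simp
    let ?C = "{c \<in> carrier G. c \<otimes> y = y \<otimes> c}"
    let ?D = "{c \<in> carrier G. c \<otimes> y \<noteq> y \<otimes> c \<and> c \<otimes> y \<noteq> y \<otimes> inv c}"
    \<comment> \<open>If both alternatives fail for \<open>c\<close>, then \<open>c\<close>,
      \<open>c \<otimes> inv y\<close> or \<open>c \<otimes> y\<close> is stray. So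
      \<open>?D\<close> has at most \<open>3 * card stray\<close> elements, and 36 = 3 * 12 meets
      the demand of \<open>inverted_halfI\<close>.\<close>
    have "?D \<subseteq> stray \<union> (\<lambda>d. d \<otimes> y) ` stray \<union> (\<lambda>d. d \<otimes> inv y) ` stray"
    proof
      fix c assume c: "c \<in> ?D"
      then have "c \<in> stray \<or> c \<otimes> inv y \<in> stray \<or> c \<otimes> y \<in> stray"
        using flipped_commutes_or_inverts[of y c] invol y by auto
      moreover have "c = c \<otimes> inv y \<otimes> y" "c = c \<otimes> y \<otimes> inv y"
        using c yc by (auto simp: group_norm)
      ultimately show "c \<in> stray \<union> (\<lambda>d. d \<otimes> y) ` stray \<union> (\<lambda>d. d \<otimes> inv y) ` stray"
        by blast
    qed
    then have "card ?D \<le> card (stray \<union> (\<lambda>d. d \<otimes> y) ` stray \<union> (\<lambda>d. d \<otimes> inv y) ` stray)"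
      using fD by (intro card_mono) auto
    also have "\<dots> \<le> card stray + card ((\<lambda>d. d \<otimes> y) ` stray) + card ((\<lambda>d. d \<otimes> inv y) ` stray)"
      by (meson add_le_mono1 card_Un_le order_trans)
    also have "\<dots> \<le> card stray + card stray + card stray"
      using fD by (intro add_mono card_image_le) auto
    finally have cD: "12 * card ?D < card (carrier G)" using small by simp
    have "inverted_half ?C"
    proof (rule inverted_halfI[where D = ?D and v = y])
      show "subgroup ?C G" using subgroup_commutant[OF subgroup_self yc] .
      show "?C \<noteq> carrier G"
      proof
        assume "?C = carrier G"
        then have "z \<in> ?C" using z by simp
        then show False using nc by simp
      qed
      show "y \<otimes> y \<noteq> \<one>" using sq y by auto
      fix u assume u: "u \<in> carrier G" "u \<notin> ?C" "u \<notin> ?D"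
      then have uy: "u \<otimes> y = y \<otimes> inv u" "u \<otimes> y \<noteq> y \<otimes> u" by auto
      show "u \<otimes> u \<noteq> \<one>" using uy u by (metis inv_equality)
      fix t assume t: "t \<in> ?C" "t \<otimes> u \<notin> ?D"
      then have tc: "t \<in> carrier G" and ty: "t \<otimes> y = y \<otimes> t" by auto
      \<comment> \<open>Moving \<open>y\<close> past \<open>u\<close> and then past \<open>t\<close>
        gives one value of \<open>t \<otimes> u \<otimes> y\<close>; comparing it with
        \<open>y \<otimes> inv (t \<otimes> u)\<close> shows that \<open>u\<close> inverts
        \<open>t\<close>.\<close>
      have e: "t \<otimes> u \<otimes> y = y \<otimes> (t \<otimes> inv u)"
      proof -
        have "t \<otimes> u \<otimes> y = t \<otimes> (u \<otimes> y)" using tc u yc by (simp add: m_assoc)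
        also have "\<dots> = (t \<otimes> y) \<otimes> inv u" unfolding uy(1) using tc u yc by (simp add: m_assoc)
        finally show ?thesis unfolding ty using tc u yc by (simp add: m_assoc)
      qed
      have "t \<otimes> u \<otimes> y \<noteq> y \<otimes> (t \<otimes> u)"
      proof
        assume "t \<otimes> u \<otimes> y = y \<otimes> (t \<otimes> u)"
        then have "t \<otimes> inv u = t \<otimes> u" using e tc u yc by simp
        then show False using uy tc u by simp
      qed
      then have "t \<otimes> u \<otimes> y = y \<otimes> inv (t \<otimes> u)" using t u tc by auto
      then have "t \<otimes> inv u = inv u \<otimes> inv t" using e tc u yc by (simp add: inv_mult_group)
      then have "u \<otimes> (t \<otimes> inv u) \<otimes> u = u \<otimes> (inv u \<otimes> inv t) \<otimes> u" by simp
      then show "u \<otimes> t = inv t \<otimes> u" using tc u by (simp add: group_norm)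
    qed (use yc cD fin in auto)
    then show False using no_half by blast
  qed
  have ff: "finite fixed" using fin by (simp add: fixed_def)
  have FC: "fixed \<subseteq> carrier G" by (auto simp: fixed_def)
  have "2 * card fixed \<le> card (carrier G)"
    using proper_subgroup_card[OF fin subgroup_fixed subgroup_self] proper FC by blast
  moreover have "card (carrier G) \<le> card fixed + card stray + card ?I"
  proof -
    have "carrier G \<subseteq> fixed \<union> stray \<union> ?I" by blast
    then have "card (carrier G) \<le> card (fixed \<union> stray \<union> ?I)"
      using fin ff fD by (intro card_mono) auto
    also have "\<dots> \<le> card fixed + card stray + card ?I"
      by (meson add_le_mono1 card_Un_le order_trans)
    finally show ?thesis .
  qed
  ultimately have I: "card (carrier G) < 3 * card ?I" using small by linarith
  then have "?I \<noteq> {}" by (metis card.empty mult_0_right not_less_zero)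
  then obtain y0 where y0: "y0 \<in> ?I" by blast
  have "a \<otimes> b = b \<otimes> a" if a: "a \<in> carrier G" and b: "b \<in> carrier G" for a b
  proof (rule ccontr)
    assume ab: "a \<otimes> b \<noteq> b \<otimes> a"
    \<comment> \<open>Two proper inclusions bound the common centraliser \<open>?K\<close> of
      \<open>a\<close> and \<open>b\<close> by a quarter of the group, yet it contains the central
      set \<open>?I\<close>.\<close>
    let ?C = "{c \<in> carrier G. c \<otimes> a = a \<otimes> c}"
    have C: "subgroup ?C G" using subgroup_commutant[OF subgroup_self a] .
    let ?K = "{c \<in> ?C. c \<otimes> b = b \<otimes> c}"
    have K: "subgroup ?K G" using subgroup_commutant[OF C b] .
    have "2 * card ?K \<le> card ?C"
      using ab a by (intro proper_subgroup_card[OF fin K C]) blast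
    moreover have "2 * card ?C \<le> card (carrier G)"
    proof (rule proper_subgroup_card[OF fin C subgroup_self], rule psubsetI)
      have "b \<notin> ?C" using ab by auto
      then show "?C \<noteq> carrier G" using b by blast
    qed auto
    moreover have "card ?I \<le> card ?K"
      using central a b fin by (intro card_mono) auto
    ultimately show False using I by linarith
  qed
  then have "comm_group G" by (intro group_comm_groupI) auto
  then show False using no_abelian sq y0 by blast
qed

end


section \<open>Difference covers and averaging\<close>

text \<open>\<open>A\<close> is any set of size \<open>a\<close>, and \<open>B\<close> is chosen
  greedily; \<open>U B\<close> collects what is not yet covered. Exactly \<open>a\<close> choices of
  \<open>b\<close> cover a given \<open>y\<close>, so on average over \<open>b\<close> a fraction
  \<open>a / n\<close> of \<open>U B\<close> gets covered, and some \<open>b\<close> does at least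
  as well. After \<open>j\<close> choices at most \<open>n (1 - a/n)^j\<close> elements remain,
  which is less than one by hypothesis.\<close>

lemma (in group) difference_cover:
  assumes fin: "finite (carrier G)" and a: "a \<le> card (carrier G)"
    and j: "card (carrier G) * (card (carrier G) - a) ^ j < card (carrier G) ^ j"
  obtains A B where "A \<subseteq> carrier G" "card A = a" "B \<subseteq> carrier G" "card B \<le> j"
    "\<And>y. y \<in> carrier G \<Longrightarrow> \<exists>b\<in>B. y \<otimes> b \<in> A"
proof -
  let ?n = "card (carrier G)"
  obtain A where A: "A \<subseteq> carrier G" "card A = a" using obtain_subset_with_card_n[OF a] by metis
  have fA: "finite A" using A fin finite_subset by blast
  define U where "U = (\<lambda>B. {y \<in> carrier G. \<forall>b\<in>B. y \<otimes> b \<notin> A})"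
  have fU: "finite (U B)" for B using fin by (simp add: U_def)
  \<comment> \<open>Multiplied by \<open>?n ^ j\<close>, the geometric estimate stays within the
    naturals.\<close>
  have "\<exists>B\<subseteq>carrier G. card B \<le> j \<and> card (U B) * ?n ^ j \<le> ?n * (?n - a) ^ j" for j
  proof (induction j)
    case 0
    show ?case by (intro exI[of _ "{}"]) (simp add: U_def)
  next
    case (Suc j)
    then obtain B where B: "B \<subseteq> carrier G" "card B \<le> j" "card (U B) * ?n ^ j \<le> ?n * (?n - a) ^ j"
      by blast
    have "(\<Sum>b\<in>carrier G. card {y \<in> U B. y \<otimes> b \<in> A}) = (\<Sum>y\<in>U B. card {b \<in> carrier G. y \<otimes> b \<in> A})"
      using fin fU by (rule sum_multicount_gen) auto
    also have "\<dots> = (\<Sum>y\<in>U B. a)"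
    proof (rule sum.cong)
      fix y assume "y \<in> U B"
      then have y: "y \<in> carrier G" by (simp add: U_def)
      have "{b \<in> carrier G. y \<otimes> b \<in> A} = (\<lambda>x. inv y \<otimes> x) ` A"
      proof (intro equalityI subsetI)
        fix b assume b: "b \<in> {b \<in> carrier G. y \<otimes> b \<in> A}"
        then have "b = inv y \<otimes> (y \<otimes> b)" using y by (simp add: inv_mult_cancel)
        then show "b \<in> (\<lambda>x. inv y \<otimes> x) ` A" using b by blast
      qed (use A y in \<open>auto simp: inv_mult_cancel subsetD\<close>)
      then show "card {b \<in> carrier G. y \<otimes> b \<in> A} = a"
        using A y by (simp add: card_image inj_on_left_mult)
    qed simp
    finally have sum: "(\<Sum>b\<in>carrier G. card {y \<in> U B. y \<otimes> b \<in> A}) = card (U B) * a" by simp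
    have "\<exists>b\<in>carrier G. card (U B) * a \<le> card {y \<in> U B. y \<otimes> b \<in> A} * ?n"
    proof (rule ccontr)
      assume "\<not> ?thesis"
      then have "(\<Sum>b\<in>carrier G. card {y \<in> U B. y \<otimes> b \<in> A} * ?n) < (\<Sum>b\<in>carrier G. card (U B) * a)"
        using fin by (intro sum_strict_mono) (auto simp: not_le)
      then show False unfolding sum_distrib_right[symmetric] sum by simp
    qed
    then obtain b where b: "b \<in> carrier G" "card (U B) * a \<le> card {y \<in> U B. y \<otimes> b \<in> A} * ?n"
      by blast
    have "U (insert b B) = U B - {y \<in> U B. y \<otimes> b \<in> A}" by (auto simp: U_def)
    then have "card (U (insert b B)) = card (U B) - card {y \<in> U B. y \<otimes> b \<in> A}"
      using fU by (metis (no_types, lifting) card_Diff_subset finite_subset mem_Collect_eq subsetI)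
    then have "card (U (insert b B)) * ?n \<le> card (U B) * (?n - a)"
      using b by (simp add: diff_mult_distrib diff_mult_distrib2 diff_le_mono2)
    then have "card (U (insert b B)) * ?n * ?n ^ j \<le> card (U B) * (?n - a) * ?n ^ j"
      by (rule mult_right_mono) simp
    also have "\<dots> \<le> (?n - a) * (?n * (?n - a) ^ j)" using B(3) by (simp add: mult.commute mult.left_commute)
    finally have "card (U (insert b B)) * ?n ^ Suc j \<le> ?n * (?n - a) ^ Suc j"
      by (simp add: mult_ac)
    moreover have "card (insert b B) \<le> Suc j"
      using B(2) card_insert_le_m1 by (metis card_insert_if finite_subset[OF B(1) fin] le_SucI Suc_le_mono)
    ultimately show ?case using B b by (intro exI[of _ "insert b B"]) auto
  qed
  then obtain B where B: "B \<subseteq> carrier G" "card B \<le> j" "card (U B) * ?n ^ j \<le> ?n * (?n - a) ^ j"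
    by blast
  have "card (U B) = 0"
  proof (rule ccontr)
    assume "card (U B) \<noteq> 0"
    then have "?n ^ j \<le> card (U B) * ?n ^ j" by simp
    then show False using B(3) j by linarith
  qed
  then have "U B = {}" using fU by simp
  then show thesis using that[OF A B(1,2)] by (auto simp: U_def)
qed

section \<open>Averaging over the family\<close>

context stabiliser_family
begin

lemma finite_family: "finite A"
proof (rule finite_subset)
  show "A \<subseteq> carrier G \<rightarrow>\<^sub>E carrier G"
    using Bij_imp_extensional[OF Bij] by (auto simp: PiE_def extensional_def)
  show "finite (carrier G \<rightarrow>\<^sub>E carrier G)" using fin by (simp add: finite_PiE)
qed

lemma inj_on_carrier: "g \<in> A \<Longrightarrow> inj_on g (carrier G)"
  using Bij by (auto simp: Bij_def bij_betw_def)

lemma eq_on_carrier: "f \<in> A \<Longrightarrow> g \<in> A \<Longrightarrow> (\<And>x. x \<in> carrier G \<Longrightarrow> f x = g x) \<Longrightarrow> f = g"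
  by (rule extensionalityI[of _ "carrier G"]) (auto intro: Bij_imp_extensional[OF Bij])

lemma inj_on_compose:
  assumes "f \<in> A" "B \<subseteq> A"
  shows "inj_on (\<lambda>g. compose (carrier G) f g) B"
proof (rule inj_onI)
  fix g h assume gh: "g \<in> B" "h \<in> B" "compose (carrier G) f g = compose (carrier G) f h"
  show "g = h"
  proof (rule eq_on_carrier)
    fix x assume x: "x \<in> carrier G"
    then have "f (g x) = f (h x)" using gh(3) by (metis compose_eq)
    then show "g x = h x"
      using inj_on_carrier[OF assms(1)] gh assms(2) x by (meson closed inj_onD subsetD)
  qed (use gh assms in auto)
qed

text \<open>The maps with a prescribed value at \<open>y\<close> form a coset of a point stabiliser:
  composition with \<open>g0\<close> after an inverse of \<open>g1\<close> injects the fibre over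
  \<open>w\<close> into the fibre over \<open>z\<close>.\<close>

lemma fibre_le:
  assumes g0: "g0 \<in> A" "g0 y = z" and y: "y \<in> carrier G" and g1: "g1 \<in> A" "g1 y = w"
  shows "card {g \<in> A. g y = w} \<le> card {g \<in> A. g y = z}"
proof -
  obtain f1 where f1: "f1 \<in> A" "\<And>x. x \<in> carrier G \<Longrightarrow> f1 (g1 x) = x" using inverse[OF g1(1)] by blast
  let ?c = "compose (carrier G) g0 f1"
  have c: "?c \<in> A" using comp g0 f1 by simp
  have "?c w = z"
    using f1(2)[OF y] g1 g0 y closed[OF g1(1) y] by (simp add: compose_eq)
  then have "(\<lambda>g. compose (carrier G) ?c g) ` {g \<in> A. g y = w} \<subseteq> {g \<in> A. g y = z}"
    using comp[OF c] y by (auto simp: compose_eq)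
  then show ?thesis
    using inj_on_compose[OF c, of "{g \<in> A. g y = w}"] finite_family
    by (intro card_inj_on_le) auto
qed

text \<open>As \<open>y\<close> is stray, the maps moving it out of its pair include a full fibre,
  the one over \<open>g0 y\<close>. The fibres over \<open>y\<close> and \<open>inv y\<close> are no
  larger, so \<open>A\<close> splits into three parts bounded by the same number.\<close>

lemma card_family_le:
  assumes "y \<in> stray"
  shows "card A \<le> 3 * card {g \<in> A. g y \<notin> inv_pair y}"
proof -
  obtain g0 where g0: "g0 \<in> A" "g0 y \<notin> inv_pair y" and y: "y \<in> carrier G"
    using assms by (auto simp: stray_def)
  let ?F = "\<lambda>w. {g \<in> A. g y = w}" and ?M = "{g \<in> A. g y \<notin> inv_pair y}"
  have le: "card (?F w) \<le> card ?M" for w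
  proof (cases "?F w = {}")
    case True
    then show ?thesis by (metis card.empty zero_le)
  next
    case False
    then obtain g1 where "g1 \<in> A" "g1 y = w" by auto
    then have "card (?F w) \<le> card (?F (g0 y))" using fibre_le g0 y by blast
    also have "\<dots> \<le> card ?M" using g0 finite_family by (intro card_mono) auto
    finally show ?thesis .
  qed
  have "A \<subseteq> ?F y \<union> ?F (inv y) \<union> ?M" by (auto simp: inv_pair_def)
  then have "card A \<le> card (?F y \<union> ?F (inv y) \<union> ?M)"
    using finite_family by (intro card_mono) auto
  also have "\<dots> \<le> card (?F y) + card (?F (inv y)) + card ?M"
    by (meson add_le_mono1 card_Un_le order_trans)
  finally show ?thesis using le[of y] le[of "inv y"] by linarith
qed

definition shifted :: "'a \<Rightarrow> ('a \<Rightarrow> 'a) \<Rightarrow> 'a \<Rightarrow> 'a" where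
  "shifted r g = (\<lambda>y\<in>carrier G. g (y \<otimes> r) \<otimes> inv (g r))"

lemma bij_betw_shifted:
  assumes r: "r \<in> carrier G"
  shows "bij_betw (shifted r) A A"
proof -
  have "inj_on (shifted r) A"
  proof (rule inj_onI)
    fix f g assume f: "f \<in> A" and g: "g \<in> A" and eq: "shifted r f = shifted r g"
    have e: "f (y \<otimes> r) \<otimes> inv (f r) = g (y \<otimes> r) \<otimes> inv (g r)" if "y \<in> carrier G" for y
      using fun_cong[OF eq, of y] that by (simp add: shifted_def)
    \<comment> \<open>At \<open>inv r\<close> the shift of \<open>f\<close> takes the value
      \<open>inv (f r)\<close>, so \<open>f r\<close> can be read off, and with it all of
      \<open>f\<close>.\<close>
    have "inv (f r) = inv (g r)"
      using e[of "inv r"] r f g fix_one[OF f] fix_one[OF g] by simp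
    then have fr: "f r = g r" using r f g by (metis closed inv_inv)
    show "f = g"
    proof (rule eq_on_carrier[OF f g])
      fix x assume x: "x \<in> carrier G"
      then have "f x \<otimes> inv (g r) = g x \<otimes> inv (g r)"
        using e[of "x \<otimes> inv r"] r fr by (simp add: m_assoc)
      then show "f x = g x" using x r f g by simp
    qed
  qed
  moreover have "shifted r ` A \<subseteq> A" using shift r by (auto simp: shifted_def)
  ultimately show ?thesis using finite_family by (simp add: bij_betw_def endo_inj_surj)
qed

text \<open>
  The average runs over \<open>g\<close> in the family: shifting permutes the family, so for each \<open>y\<close> the
  shift parameter \<open>e y\<close> does not affect how many \<open>g\<close> count.
\<close>

lemma exists_moving_many:
  assumes e: "\<And>y. y \<in> carrier G \<Longrightarrow> e y \<in> carrier G" and ne: "A \<noteq> {}"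
  shows "\<exists>g\<in>A. card stray \<le> 3 * card (moved (\<lambda>y. g (y \<otimes> e y) \<otimes> inv (g (e y))))"
proof (rule ccontr)
  assume "\<not> ?thesis"
  then have small: "3 * card (moved (\<lambda>y. g (y \<otimes> e y) \<otimes> inv (g (e y)))) < card stray" if "g \<in> A" for g
    using that by (auto simp: not_le)
  have fD: "finite stray" using fin by (simp add: stray_def)
  have eq: "card {g \<in> A. g (y \<otimes> e y) \<otimes> inv (g (e y)) \<notin> inv_pair y} = card {g \<in> A. g y \<notin> inv_pair y}"
    if y: "y \<in> carrier G" for y
  proof -
    have b: "bij_betw (shifted (e y)) A A" using bij_betw_shifted e y by blast
    have "shifted (e y) ` {g \<in> A. shifted (e y) g y \<notin> inv_pair y} = {g \<in> A. g y \<notin> inv_pair y}"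
      using b by (force simp: bij_betw_def)
    moreover have "inj_on (shifted (e y)) {g \<in> A. shifted (e y) g y \<notin> inv_pair y}"
      using b by (auto simp: bij_betw_def intro: inj_on_subset)
    then have "card (shifted (e y) ` {g \<in> A. shifted (e y) g y \<notin> inv_pair y})
        = card {g \<in> A. shifted (e y) g y \<notin> inv_pair y}"
      by (rule card_image)
    ultimately have "card {g \<in> A. shifted (e y) g y \<notin> inv_pair y} = card {g \<in> A. g y \<notin> inv_pair y}"
      by simp
    then show ?thesis using y by (simp add: shifted_def)
  qed
  have "card stray * card A = (\<Sum>y\<in>stray. card A)" by simp
  also have "\<dots> \<le> (\<Sum>y\<in>stray. 3 * card {g \<in> A. g (y \<otimes> e y) \<otimes> inv (g (e y)) \<notin> inv_pair y})"
  proof (rule sum_mono)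
    fix y assume y: "y \<in> stray"
    then have "y \<in> carrier G" by (simp add: stray_def)
    then show "card A \<le> 3 * card {g \<in> A. g (y \<otimes> e y) \<otimes> inv (g (e y)) \<notin> inv_pair y}"
      using card_family_le[OF y] eq by simp
  qed
  also have "\<dots> = 3 * (\<Sum>y\<in>stray. card {g \<in> A. g (y \<otimes> e y) \<otimes> inv (g (e y)) \<notin> inv_pair y})"
    by (simp add: sum_distrib_left)
  also have "(\<Sum>y\<in>stray. card {g \<in> A. g (y \<otimes> e y) \<otimes> inv (g (e y)) \<notin> inv_pair y})
      = (\<Sum>g\<in>A. card {y \<in> stray. g (y \<otimes> e y) \<otimes> inv (g (e y)) \<notin> inv_pair y})"
    using fD finite_family by (rule sum_multicount_gen) auto
  also have "3 * \<dots> = (\<Sum>g\<in>A. 3 * card {y \<in> stray. g (y \<otimes> e y) \<otimes> inv (g (e y)) \<notin> inv_pair y})"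
    by (simp add: sum_distrib_left)
  also have "\<dots> < (\<Sum>g\<in>A. card stray)"
  proof (rule sum_strict_mono[OF finite_family ne])
    fix g assume g: "g \<in> A"
    have "card {y \<in> stray. g (y \<otimes> e y) \<otimes> inv (g (e y)) \<notin> inv_pair y}
        \<le> card (moved (\<lambda>y. g (y \<otimes> e y) \<otimes> inv (g (e y))))"
      using fin by (intro card_mono) (auto simp: moved_def stray_def)
    then show "3 * card {y \<in> stray. g (y \<otimes> e y) \<otimes> inv (g (e y)) \<notin> inv_pair y} < card stray"
      using small[OF g] by linarith
  qed
  finally show False by (simp add: mult.commute)
qed

end


section \<open>Counting connection sets\<close>

text \<open>With \<open>L = log 2 n\<close> the hypothesis says that \<open>2 powr (L / 2)\<close>
  exceeds \<open>192 * (2 * L + L\<^sup>2 + 3)\<close>. Crude bounds refute this separately below 4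
  and from 4 to 21. The threshold 21 serves to give \<open>sqrt L \<ge> 9 / 2\<close> in
  \<open>cover_size\<close>.\<close>

lemma log_large_if_sqrt_large:
  fixes n :: nat
  assumes "n \<ge> 1" and large: "sqrt n / 192 > 2 * log 2 n + (log 2 n)\<^sup>2 + 3"
  shows "log 2 n \<ge> 21"
proof (rule ccontr)
  define L where "L = log 2 n"
  assume "\<not> ?thesis"
  then have L: "L < 21" "L \<ge> 0" using assms(1) by (auto simp: L_def)
  have n: "real n = 2 powr L" using assms(1) by (simp add: L_def)
  have s: "sqrt n = 2 powr (L / 2)" unfolding n by (simp add: powr_half_sqrt[symmetric] powr_powr)
  show False
  proof (cases "L < 4")
    case True
    then have "sqrt n \<le> 2 powr 2" unfolding s by (intro powr_mono) auto
    then have "sqrt n \<le> 4" by simp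
    moreover have "2 * L + L\<^sup>2 + 3 \<ge> 3" using L by simp
    ultimately show False using large by (simp add: L_def[symmetric])
  next
    case False
    have "sqrt n \<le> 2 powr 11" unfolding s using L by (intro powr_mono) auto
    then have "sqrt n \<le> 2048" by simp
    moreover have "L\<^sup>2 \<ge> 16" using False power_mono[of 4 L 2] by simp
    ultimately show False using large False by (simp add: L_def[symmetric])
  qed
qed

text \<open>With \<open>j = a\<close> the covering condition reads \<open>n (1 - a/n)\<^sup>a < 1\<close>, which \<open>a\<^sup>2 \<ge> n log n\<close> ensures.\<close>

lemma cover_size:
  fixes n :: nat
  assumes n: "n \<ge> 1" and large: "sqrt n / 192 > 2 * log 2 n + (log 2 n)\<^sup>2 + 3"
  obtains a :: nat where "a \<le> n" "n * (n - a) ^ a < n ^ a"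
    "2 * real a * log 2 n - n / 432 \<le> 2 * log 2 n + (log 2 n)\<^sup>2 + 3 - sqrt n / 192"
proof -
  define L where "L = log 2 n"
  define s where "s = sqrt n"
  \<comment> \<open>Since \<open>s * s = n\<close>, rounding up ensures
    \<open>a\<^sup>2 \<ge> n * L\<close>.\<close>
  define a where "a = nat \<lceil>s * sqrt L\<rceil>"
  have L: "L \<ge> 21" using log_large_if_sqrt_large[OF assms] by (simp add: L_def)
  have s: "s > 384 * L + 192 * L\<^sup>2 + 576" "s > 0" "s * s = n"
    using large n by (auto simp: s_def L_def)
  have L2: "L \<le> L\<^sup>2" using L by (simp add: power2_eq_square)
  have s1: "L + 1 \<le> s" using s(1) L L2 by linarith
  then have s2: "1 \<le> s" using L by simp
  have a1: "real a \<ge> s * sqrt L" and a2: "real a \<le> s * sqrt L + 1"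
    using s L unfolding a_def by (smt (verit) mult_nonneg_nonneg of_nat_nat of_int_ceiling_le_add_one le_of_int_ceiling real_sqrt_ge_zero zero_le_ceiling)+
  have "4 \<le> sqrt L" using L by (intro real_le_rsqrt) simp
  have sL: "sqrt L \<le> L" using L by (intro real_le_lsqrt) (auto simp: power2_eq_square)
  have "s * sqrt L + 1 \<le> s * (L + 1)"
    using mult_left_mono[OF sL less_imp_le[OF s(2)]] s2 unfolding distrib_left by linarith
  also have "\<dots> \<le> s * s" using s1 s2 by (intro mult_left_mono) auto
  finally have an: "a \<le> n" using a2 s by simp
  \<comment> \<open>A logarithm to base 2 exceeds the natural one, so \<open>n * exp (- L)\<close>
    stays below 1.\<close>
  have "exp (ln n) < exp L"
  proof -
    have "ln n = L * ln 2" by (simp add: L_def log_def)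
    also have "\<dots> < L * 1" using L ln_2_less_1 by (intro mult_strict_left_mono) auto
    finally show ?thesis by simp
  qed
  then have nL: "n < exp L" using n by simp
  have "real (n - a) = n * (1 - a / n)" using an n by (simp add: of_nat_diff field_simps)
  then have "real ((n - a) ^ a) = (n * (1 - a / n)) ^ a" by (metis of_nat_power)
  also have "\<dots> = n ^ a * (1 - a / n) ^ a" by (simp add: power_mult_distrib)
  also have "(1 - a / n) ^ a \<le> exp (- (a / n)) ^ a"
    using an n exp_ge_add_one_self[of "- (a / n)"] by (intro power_mono) auto
  also have "exp (- (a / n)) ^ a = exp (- (a * a / n))"
    by (simp add: exp_of_nat_mult[symmetric])
  also have "\<dots> \<le> exp (- L)"
  proof -
    have "(s * sqrt L) * (s * sqrt L) \<le> real a * real a" using a1 s L by (intro mult_mono) auto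
    moreover have "(s * sqrt L) * (s * sqrt L) = (s * s) * (sqrt L * sqrt L)" by (simp only: mult_ac)
    ultimately have "n * L \<le> real a * real a" using s L by simp
    then show ?thesis using n by (simp add: field_simps)
  qed
  finally have "real ((n - a) ^ a) \<le> n ^ a * exp (- L)" using n by simp
  then have "n * real ((n - a) ^ a) \<le> n * (n ^ a * exp (- L))" by (intro mult_left_mono) auto
  also have "\<dots> < exp L * (n ^ a * exp (- L))" using nL n by (intro mult_strict_right_mono) auto
  also have "\<dots> = n ^ a" by (simp add: exp_minus)
  finally have "real (n * (n - a) ^ a) < real (n ^ a)" by simp
  then have cov: "n * (n - a) ^ a < n ^ a" by (simp only: of_nat_less_iff)
  \<comment> \<open>The bound on \<open>s\<close> gives \<open>s / 432 > 4 / 9 * L\<^sup>2\<close>,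
    because 192/432 = 4/9; for this to dominate \<open>2 * L * sqrt L\<close> one needs
    \<open>L \<ge> 9 / 2 * sqrt L\<close>.\<close>
  have "sqrt L \<ge> 9 / 2" using L by (intro real_le_rsqrt) (simp add: power2_eq_square)
  then have "9 / 2 * sqrt L \<le> L" using L mult_right_mono[of "9/2" "sqrt L" "sqrt L"] by simp
  then have "L * (9 / 2 * sqrt L) \<le> L * L" using L by (intro mult_left_mono) auto
  then have "2 * L * sqrt L + 1 / 192 \<le> s / 432"
    using s(1) L unfolding power2_eq_square by linarith
  then have "s * (2 * L * sqrt L + 1 / 192) \<le> s * (s / 432)" using s by (intro mult_left_mono) auto
  then have "2 * L * (s * sqrt L) + s / 192 \<le> n / 432" using s(3) by (simp add: algebra_simps)
  \<comment> \<open>Rounding \<open>a\<close> up costs at most \<open>2 * L\<close>, a term that the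
    right-hand side of the claim also contains.\<close>
  moreover have "2 * real a * L \<le> 2 * L * (s * sqrt L) + 2 * L"
    using mult_left_mono[OF a2, of "2 * L"] L by (simp add: algebra_simps)
  ultimately have "2 * real a * L - n / 432 \<le> 2 * L + L\<^sup>2 + 3 - s / 192"
    using L L2 by linarith
  then show thesis using that[OF an cov] by (simp add: L_def s_def)
qed

section \<open>Vertex stabilisers and the union bound\<close>

context group
begin

text \<open>Arc preservation, parametrised by the start \<open>r\<close> and the quotient
  \<open>y\<close> of an arc from \<open>r\<close> to \<open>y \<otimes> r\<close>. In this form
  closure under shifts is a substitution.\<close>

definition vertex_stabiliser :: "'a set \<Rightarrow> ('a \<Rightarrow> 'a) set" where
  "vertex_stabiliser S = {g \<in> Bij (carrier G). g \<one> = \<one> \<and>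
     (\<forall>y\<in>carrier G. \<forall>r\<in>carrier G. g (y \<otimes> r) \<otimes> inv (g r) \<in> S \<longleftrightarrow> y \<in> S)}"

lemma stabiliser_family_vertex_stabiliser:
  assumes fin: "finite (carrier G)"
  shows "stabiliser_family G (vertex_stabiliser S)"
proof
  show "finite (carrier G)" by fact
  show B: "g \<in> Bij (carrier G)" and o: "g \<one> = \<one>" if "g \<in> vertex_stabiliser S" for g
    using that by (auto simp: vertex_stabiliser_def)
  have c: "g x \<in> carrier G" if "g \<in> vertex_stabiliser S" "x \<in> carrier G" for g x
    using Bij_imp_funcset[OF B[OF that(1)]] that(2) by auto
  have S: "g (y \<otimes> r) \<otimes> inv (g r) \<in> S \<longleftrightarrow> y \<in> S"
    if "g \<in> vertex_stabiliser S" "y \<in> carrier G" "r \<in> carrier G" for g y r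
    using that by (auto simp: vertex_stabiliser_def)
  show "compose (carrier G) f g \<in> vertex_stabiliser S"
    if f: "f \<in> vertex_stabiliser S" and g: "g \<in> vertex_stabiliser S" for f g
  proof -
    have "f (g (y \<otimes> r)) \<otimes> inv (f (g r)) \<in> S \<longleftrightarrow> y \<in> S" if y: "y \<in> carrier G" and r: "r \<in> carrier G" for y r
    proof -
      have "g (y \<otimes> r) = g (y \<otimes> r) \<otimes> inv (g r) \<otimes> g r" using c[OF g] y r by (simp add: m_assoc)
      then have "f (g (y \<otimes> r)) \<otimes> inv (f (g r)) \<in> S \<longleftrightarrow> g (y \<otimes> r) \<otimes> inv (g r) \<in> S"
        using S[OF f, of "g (y \<otimes> r) \<otimes> inv (g r)" "g r"] c[OF g] y r by simp
      then show ?thesis using S[OF g y r] by simp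
    qed
    then show ?thesis
      using compose_Bij[OF B[OF f] B[OF g]] o[OF f] o[OF g]
      by (simp add: vertex_stabiliser_def compose_eq)
  qed
  show "\<exists>f\<in>vertex_stabiliser S. \<forall>x\<in>carrier G. f (g x) = x" if g: "g \<in> vertex_stabiliser S" for g
  proof -
    let ?f = "\<lambda>x\<in>carrier G. inv_into (carrier G) g x"
    have bij: "bij_betw g (carrier G) (carrier G)" using B[OF g] by (simp add: Bij_def)
    have fg: "?f (g x) = x" if "x \<in> carrier G" for x
      using bij that c[OF g] by (simp add: bij_betw_inv_into_left)
    have fB: "?f \<in> Bij (carrier G)" using restrict_inv_into_Bij[OF B[OF g]] by simp
    have "?f (y \<otimes> r) \<otimes> inv (?f r) \<in> S \<longleftrightarrow> y \<in> S" if y: "y \<in> carrier G" and r: "r \<in> carrier G" for y r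
    proof -
      obtain p where p: "p \<in> carrier G" "g p = y \<otimes> r"
        using bij y r by (metis bij_betw_imp_surj_on imageE m_closed)
      obtain q where q: "q \<in> carrier G" "g q = r"
        using bij r by (metis bij_betw_imp_surj_on imageE)
      have "?f (y \<otimes> r) = p" "?f r = q" using fg[OF p(1)] fg[OF q(1)] p q by simp_all
      moreover have "p \<otimes> inv q \<otimes> q = p" using p q by (simp add: m_assoc)
      then have "p \<otimes> inv q \<in> S \<longleftrightarrow> y \<otimes> r \<otimes> inv r \<in> S"
        using S[OF g, of "p \<otimes> inv q" q] p q by simp
      ultimately show ?thesis using y r by (simp add: m_assoc)
    qed
    moreover have "?f \<one> = \<one>" using fg[of \<one>] o[OF g] by simp
    ultimately have "?f \<in> vertex_stabiliser S" using fB unfolding vertex_stabiliser_def by blast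
    then show ?thesis using fg by blast
  qed
  show "(\<lambda>y\<in>carrier G. g (y \<otimes> r) \<otimes> inv (g r)) \<in> vertex_stabiliser S"
    if g: "g \<in> vertex_stabiliser S" and r: "r \<in> carrier G" for g r
  proof -
    let ?h = "\<lambda>y\<in>carrier G. g (y \<otimes> r) \<otimes> inv (g r)"
    have inj: "inj_on g (carrier G)" using B[OF g] by (auto simp: Bij_def bij_betw_def)
    have "inj_on ?h (carrier G)"
    proof (rule inj_onI)
      fix x y assume xy: "x \<in> carrier G" "y \<in> carrier G" "?h x = ?h y"
      then have "g (x \<otimes> r) = g (y \<otimes> r)" using c[OF g] r by simp
      then have "x \<otimes> r = y \<otimes> r" using inj xy r by (meson inj_onD m_closed)
      then show "x = y" using xy r by simp
    qed
    moreover have "?h ` carrier G \<subseteq> carrier G"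
      by (rule image_subsetI) (simp add: c[OF g] r)
    ultimately have "bij_betw ?h (carrier G) (carrier G)"
      unfolding bij_betw_def using endo_inj_surj[OF fin] by metis
    then have "?h \<in> Bij (carrier G)" by (simp add: Bij_def)
    moreover have "?h \<one> = \<one>" using c[OF g] r by simp
    moreover have "?h (y \<otimes> x) \<otimes> inv (?h x) \<in> S \<longleftrightarrow> y \<in> S"
      if y: "y \<in> carrier G" and x: "x \<in> carrier G" for x y
    proof -
      \<comment> \<open>The factors \<open>inv (g r)\<close> of the two values cancel, which leaves
        the condition on \<open>g\<close> at the vertex \<open>x \<otimes> r\<close>.\<close>
      have "?h (y \<otimes> x) \<otimes> inv (?h x) = g (y \<otimes> (x \<otimes> r)) \<otimes> inv (g (x \<otimes> r))"
        using c[OF g] x y r by (simp add: group_norm)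
      then show ?thesis using S[OF g y, of "x \<otimes> r"] x r by simp
    qed
    ultimately show ?thesis unfolding vertex_stabiliser_def by blast
  qed
qed

text \<open>The other inverse-closed sets are the connection sets of graphical regular
  representations.\<close>

definition asymmetry_failures :: "'a set set" where
  "asymmetry_failures = {S. S \<subseteq> carrier G \<and> S = set_inv S \<and>
     (\<exists>g\<in>vertex_stabiliser S. \<exists>y\<in>carrier G. g y \<noteq> y)}"

text \<open>A union bound over the partial maps \<open>\<gamma>\<close> in \<open>P\<close>. The
  factor 36 from \<open>order_le_stray\<close> and 3 from \<open>exists_moving_many\<close> make the
  108 in \<open>P\<close>; the division by 4 in \<open>card_invariant_inverse_closed\<close> turns
  it into 432.\<close>

lemma card_asymmetry_failures_cover:
  assumes fin: "finite (carrier G)"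
    and no_half: "\<And>H. \<not> inverted_half H"
    and no_abelian: "\<not> (comm_group G \<and> (\<exists>y\<in>carrier G. y \<otimes> y \<noteq> \<one>))"
    and C: "C \<subseteq> carrier G" and B: "B \<subseteq> carrier G"
    and cover: "\<And>y. y \<in> carrier G \<Longrightarrow> \<exists>b\<in>B. y \<otimes> b \<in> C"
  shows "real (card asymmetry_failures)
           \<le> real (order G) ^ card (B \<union> C) * 2 powr (cc G - real (order G) / 432)"
proof -
  define e where "e = (\<lambda>y. SOME b. b \<in> B \<and> y \<otimes> b \<in> C)"
  have e: "e y \<in> B" "y \<otimes> e y \<in> C" if "y \<in> carrier G" for y
    unfolding e_def using someI_ex[of "\<lambda>b. b \<in> B \<and> y \<otimes> b \<in> C"] cover[OF that] by blast+
  \<comment> \<open>On the carrier \<open>e y\<close> lies in \<open>B\<close> and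
    \<open>y \<otimes> e y\<close> in \<open>C\<close>, so \<open>h \<gamma>\<close> depends there
    only on the values of \<open>\<gamma>\<close> on \<open>B \<union> C\<close>.\<close>
  define h where "h = (\<lambda>\<gamma> y. \<gamma> (y \<otimes> e y) \<otimes> inv (\<gamma> (e y)))"
  define P where "P = {\<gamma> \<in> B \<union> C \<rightarrow>\<^sub>E carrier G. order G \<le> 108 * card (moved (h \<gamma>))}"
  define F where "F = (\<lambda>\<gamma>. {S. S \<subseteq> carrier G \<and> S = set_inv S \<and> (\<forall>y\<in>carrier G. h \<gamma> y \<in> S \<longleftrightarrow> y \<in> S)})"
  have fBC: "finite (B \<union> C)" using B C fin finite_subset by blast
  have fE: "finite (B \<union> C \<rightarrow>\<^sub>E carrier G)" using fBC fin by (intro finite_PiE) auto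
  then have fP: "finite P" by (simp add: P_def)
  have fF: "finite (F \<gamma>)" for \<gamma>
    by (rule finite_subset[of _ "Pow (carrier G)"]) (use fin in \<open>auto simp: F_def\<close>)
  have "card P \<le> order G ^ card (B \<union> C)"
  proof -
    have "card P \<le> card (B \<union> C \<rightarrow>\<^sub>E carrier G)" using fE by (intro card_mono) (auto simp: P_def)
    then show ?thesis using fBC by (simp add: card_PiE order_def)
  qed
  then have cP: "real (card P) \<le> real (order G) ^ card (B \<union> C)"
    by (metis of_nat_le_iff of_nat_power)
  have cF: "real (card (F \<gamma>)) \<le> 2 powr (cc G - real (order G) / 432)" if "\<gamma> \<in> P" for \<gamma>
  proof -
    have "h \<gamma> \<in> carrier G \<rightarrow> carrier G"
      using that e unfolding h_def P_def by (auto simp: PiE_iff Pi_iff)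
    then have "real (card (F \<gamma>)) \<le> 2 powr (cc G - real (card (moved (h \<gamma>))) / 4)"
      unfolding F_def by (rule card_invariant_inverse_closed[OF fin])
    also have "\<dots> \<le> 2 powr (cc G - real (order G) / 432)"
      using that by (simp add: P_def)
    finally show ?thesis .
  qed
  have "asymmetry_failures \<subseteq> (\<Union>\<gamma>\<in>P. F \<gamma>)"
  proof
    fix S assume S: "S \<in> asymmetry_failures"
    interpret V: stabiliser_family G "vertex_stabiliser S"
      by (rule stabiliser_family_vertex_stabiliser[OF fin])
    have ex: "\<exists>g\<in>vertex_stabiliser S. \<exists>y\<in>carrier G. g y \<noteq> y"
      using S by (simp add: asymmetry_failures_def)
    have "order G \<le> 36 * card V.stray"
      unfolding order_def by (rule V.order_le_stray[OF ex no_half no_abelian])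
    moreover obtain g where g: "g \<in> vertex_stabiliser S"
      "card V.stray \<le> 3 * card (moved (\<lambda>y. g (y \<otimes> e y) \<otimes> inv (g (e y))))"
      using V.exists_moving_many[of e] e B ex by blast
    moreover define \<gamma> where "\<gamma> = restrict g (B \<union> C)"
    have hg: "h \<gamma> y = g (y \<otimes> e y) \<otimes> inv (g (e y))" if "y \<in> carrier G" for y
      using e[OF that] by (simp add: h_def \<gamma>_def)
    then have "moved (h \<gamma>) = moved (\<lambda>y. g (y \<otimes> e y) \<otimes> inv (g (e y)))"
      by (auto simp: moved_def)
    ultimately have "order G \<le> 108 * card (moved (h \<gamma>))" by simp
    moreover have "\<gamma> \<in> B \<union> C \<rightarrow>\<^sub>E carrier G" using V.closed[OF g(1)] B C by (auto simp: \<gamma>_def)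
    ultimately have "\<gamma> \<in> P" by (simp add: P_def)
    moreover have "S \<in> F \<gamma>"
    proof -
      have "h \<gamma> y \<in> S \<longleftrightarrow> y \<in> S" if y: "y \<in> carrier G" for y
        using g(1) y e(1)[OF y] B unfolding hg[OF y] vertex_stabiliser_def by blast
      then show ?thesis using S by (simp add: F_def asymmetry_failures_def)
    qed
    ultimately show "S \<in> (\<Union>\<gamma>\<in>P. F \<gamma>)" by blast
  qed
  then have "card asymmetry_failures \<le> card (\<Union>\<gamma>\<in>P. F \<gamma>)"
    using fP fF by (intro card_mono) auto
  also have "\<dots> \<le> (\<Sum>\<gamma>\<in>P. card (F \<gamma>))" by (rule card_UN_le[OF fP])
  finally have "real (card asymmetry_failures) \<le> (\<Sum>\<gamma>\<in>P. real (card (F \<gamma>)))"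
    by (metis of_nat_le_iff of_nat_sum)
  also have "\<dots> \<le> (\<Sum>\<gamma>\<in>P. 2 powr (cc G - real (order G) / 432))" using cF by (rule sum_mono)
  also have "\<dots> \<le> real (order G) ^ card (B \<union> C) * 2 powr (cc G - real (order G) / 432)"
    using cP by (simp add: mult_right_mono)
  finally show ?thesis .
qed

lemma card_inverse_closed:
  assumes fin: "finite (carrier G)"
  shows "real (card {S. S \<subseteq> carrier G \<and> S = set_inv S}) \<le> 2 powr cc G"
proof -
  have "moved (\<lambda>x. x) = {}" by (auto simp: moved_def inv_pair_def)
  then show ?thesis using card_invariant_inverse_closed[OF fin, of "\<lambda>x. x"] by simp
qed

text \<open>If the claimed exponent is at least \<open>cc G\<close>, counting all inverse-closed
  sets suffices. Otherwise \<open>cover_size\<close> applies: the two covering sets have at most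
  \<open>2 * a\<close> elements together, which adds \<open>2 * a * log 2 n\<close> to the exponent
  against the saving of \<open>n / 432\<close>.\<close>

theorem card_asymmetry_failures:
  assumes fin: "finite (carrier G)"
    and no_half: "\<And>H. \<not> inverted_half H"
    and no_abelian: "\<not> (comm_group G \<and> (\<exists>y\<in>carrier G. y \<otimes> y \<noteq> \<one>))"
  shows "real (card asymmetry_failures)
           \<le> 2 powr (cc G - sqrt (real (order G)) / 192 + 2 * log 2 (real (order G))
                + (log 2 (real (order G)))\<^sup>2 + 3)"
proof -
  let ?n = "order G"
  let ?L = "log 2 (real ?n)"
  have n: "?n \<ge> 1" using fin one_closed by (simp add: order_def card_gt_0_iff Suc_le_eq) blast
  show ?thesis
  proof (cases "sqrt ?n / 192 > 2 * ?L + ?L\<^sup>2 + 3")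
    case False
    have "finite {S. S \<subseteq> carrier G \<and> S = set_inv S}"
      by (rule finite_subset[of _ "Pow (carrier G)"]) (use fin in auto)
    then have "card asymmetry_failures \<le> card {S. S \<subseteq> carrier G \<and> S = set_inv S}"
      by (rule card_mono) (auto simp: asymmetry_failures_def)
    then have "real (card asymmetry_failures) \<le> 2 powr cc G"
      using card_inverse_closed[OF fin] by linarith
    also have "\<dots> \<le> 2 powr (cc G - sqrt ?n / 192 + 2 * ?L + ?L\<^sup>2 + 3)"
      using False by simp
    finally show ?thesis .
  next
    case True
    then obtain a where a: "a \<le> ?n" "?n * (?n - a) ^ a < ?n ^ a"
      "2 * real a * ?L - ?n / 432 \<le> 2 * ?L + ?L\<^sup>2 + 3 - sqrt ?n / 192"
      using cover_size[OF n] by blast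
    obtain C B where CB: "C \<subseteq> carrier G" "card C = a" "B \<subseteq> carrier G" "card B \<le> a"
      "\<And>y. y \<in> carrier G \<Longrightarrow> \<exists>b\<in>B. y \<otimes> b \<in> C"
      using difference_cover[OF fin] a by (metis order_def)
    have "card (B \<union> C) \<le> 2 * a" using card_Un_le[of B C] CB by linarith
    have "real (card asymmetry_failures) \<le> real ?n ^ card (B \<union> C) * 2 powr (cc G - ?n / 432)"
      by (rule card_asymmetry_failures_cover[OF fin no_half no_abelian CB(1,3,5)])
    also have "\<dots> \<le> real ?n ^ (2 * a) * 2 powr (cc G - ?n / 432)"
      using \<open>card (B \<union> C) \<le> 2 * a\<close> n by (intro mult_right_mono power_increasing) auto
    also have "real ?n ^ (2 * a) = (2 powr ?L) ^ (2 * a)" using n by simp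
    also have "\<dots> = 2 powr (2 * real a * ?L)" by (subst powr_power) (auto simp: mult_ac)
    also have "\<dots> * 2 powr (cc G - ?n / 432) = 2 powr (2 * real a * ?L + (cc G - ?n / 432))"
      by (simp add: powr_add)
    also have "\<dots> \<le> 2 powr (cc G - sqrt ?n / 192 + 2 * ?L + ?L\<^sup>2 + 3)"
      using a(3) by simp
    finally show ?thesis .
  qed
qed

end


section \<open>Automorphisms of Cayley graphs\<close>

context group
begin

text \<open>An edge does not record which endpoint plays the part of \<open>r\<close>;
  inverse-closure of \<open>S\<close> makes the two readings agree.\<close>

lemma cayley_edge_iff:
  assumes S: "S \<subseteq> carrier G" "S = set_inv S" and r: "r \<in> carrier G" and t: "t \<in> carrier G"
  shows "{r, t} \<in> cayley_edges G S \<longleftrightarrow> t \<otimes> inv r \<in> S"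
proof
  assume "{r, t} \<in> cayley_edges G S"
  then obtain r' t' where e: "{r, t} = {r', t'}" "r' \<in> carrier G" "t' \<in> carrier G" "t' \<otimes> inv r' \<in> S"
    by (auto simp: cayley_edges_def)
  then have "inv (t' \<otimes> inv r') \<in> S" using set_inv_self_iff[OF S, of "t' \<otimes> inv r'"] by simp
  then have "r' \<otimes> inv t' \<in> S" using e by (simp add: inv_mult_group)
  then show "t \<otimes> inv r \<in> S" using e by (auto simp: doubleton_eq_iff)
qed (use r t in \<open>auto simp: cayley_edges_def\<close>)

lemma carrier_cayley_aut:
  "f \<in> carrier (cayley_aut G S) \<longleftrightarrow>
     f \<in> Bij (carrier G) \<and> (\<lambda>e. f ` e) ` cayley_edges G S = cayley_edges G S"
  by (simp add: cayley_aut_def)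

lemma cayley_aut_vertex_stabiliser:
  assumes S: "S \<subseteq> carrier G" "S = set_inv S"
    and f: "f \<in> carrier (cayley_aut G S)" "f \<one> = \<one>"
  shows "f \<in> vertex_stabiliser S"
proof -
  have B: "f \<in> Bij (carrier G)" and E: "(\<lambda>e. f ` e) ` cayley_edges G S = cayley_edges G S"
    using f by (auto simp: carrier_cayley_aut)
  have inj: "inj_on f (carrier G)" using B by (auto simp: Bij_def bij_betw_def)
  have c: "f x \<in> carrier G" if "x \<in> carrier G" for x using Bij_imp_funcset[OF B] that by auto
  have "f (y \<otimes> r) \<otimes> inv (f r) \<in> S \<longleftrightarrow> y \<in> S" if y: "y \<in> carrier G" and r: "r \<in> carrier G" for y r
  proof -
    have yr: "y \<otimes> r \<in> carrier G" using y r by simp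
    have "{f r, f (y \<otimes> r)} \<in> cayley_edges G S \<longleftrightarrow> {r, y \<otimes> r} \<in> cayley_edges G S"
    proof
      assume "{f r, f (y \<otimes> r)} \<in> cayley_edges G S"
      then have "f ` {r, y \<otimes> r} \<in> (\<lambda>e. f ` e) ` cayley_edges G S" using E by simp
      then obtain e where e: "e \<in> cayley_edges G S" "f ` {r, y \<otimes> r} = f ` e" by blast
      moreover have "e \<subseteq> carrier G" using e by (auto simp: cayley_edges_def)
      ultimately have "{r, y \<otimes> r} = e"
        using inj_on_image_eq_iff[OF inj, of "{r, y \<otimes> r}" e] r yr by blast
      then show "{r, y \<otimes> r} \<in> cayley_edges G S" using e by simp
    next
      assume "{r, y \<otimes> r} \<in> cayley_edges G S"
      then have "f ` {r, y \<otimes> r} \<in> cayley_edges G S" using E by blast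
      then show "{f r, f (y \<otimes> r)} \<in> cayley_edges G S" by simp
    qed
    then have "f (y \<otimes> r) \<otimes> inv (f r) \<in> S \<longleftrightarrow> y \<otimes> r \<otimes> inv r \<in> S"
      using cayley_edge_iff[OF S c[OF r] c[OF yr]] cayley_edge_iff[OF S r yr] by simp
    then show ?thesis using y r by (simp add: m_assoc)
  qed
  then show ?thesis using B f(2) by (simp add: vertex_stabiliser_def)
qed

lemma mem_asymmetry_failures:
  assumes S: "S \<subseteq> carrier G" "S = set_inv S"
    and f: "f \<in> carrier (cayley_aut G S)" "f \<noteq> \<one>\<^bsub>cayley_aut G S\<^esub>" "f \<one> = \<one>"
  shows "S \<in> asymmetry_failures"
proof -
  have "\<exists>y\<in>carrier G. f y \<noteq> y"
  proof (rule ccontr)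
    assume "\<not> ?thesis"
    then have "f = (\<lambda>x\<in>carrier G. x)"
      using f(1) by (intro extensionalityI[of _ "carrier G"]) (auto simp: carrier_cayley_aut Bij_def)
    then show False using f(2) by (simp add: cayley_aut_def BijGroup_def)
  qed
  then show ?thesis
    using cayley_aut_vertex_stabiliser[OF S f(1,3)] S unfolding asymmetry_failures_def by blast
qed

section \<open>Automorphisms normalising the right regular representation\<close>

lemma normalizer_subset: "f \<in> normalizer K H \<Longrightarrow> f \<in> carrier K"
  by (simp add: normalizer_def stabilizer_def)

text \<open>
  An automorphism moving each element to itself or its inverse is an automorphism of every Cayley
  graph of the group, and it normalises the right regular representation.
\<close>

lemma right_regular_neq_normalizer:
  assumes S: "S \<subseteq> carrier G" "S = set_inv S"
    and hom: "\<And>a b. a \<in> carrier G \<Longrightarrow> b \<in> carrier G \<Longrightarrow> \<phi> (a \<otimes> b) = \<phi> a \<otimes> \<phi> b"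
    and pair: "\<And>y. y \<in> carrier G \<Longrightarrow> \<phi> y \<in> inv_pair y"
    and moves: "z \<in> carrier G" "\<phi> z \<noteq> z"
  shows "right_regular G (carrier G) \<noteq> normalizer (cayley_aut G S) (right_regular G (carrier G))"
proof
  let ?K = "cayley_aut G S" and ?H = "right_regular G (carrier G)"
  define f where "f = restrict \<phi> (carrier G)"
  define \<rho> where "\<rho> = (\<lambda>h. \<lambda>x\<in>carrier G. x \<otimes> h)"
  assume eq: "?H = normalizer ?K ?H"
  have H: "?H = \<rho> ` carrier G" by (simp add: right_regular_def \<rho>_def)
  \<comment> \<open>The assumed equality itself places the right multiplications in the automorphism
    group.\<close>
  have "normalizer ?K ?H \<subseteq> carrier ?K" using normalizer_subset by (rule subsetI)
  with eq have HK: "?H \<subseteq> carrier ?K" by (rule ord_eq_le_trans)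
  have HB: "\<rho> h \<in> Bij (carrier G)" if "h \<in> carrier G" for h
    using HK that unfolding H by (auto simp: carrier_cayley_aut)
  have c: "\<phi> y \<in> carrier G" if "y \<in> carrier G" for y using pair[OF that] that by (auto simp: inv_pair_def)
  have one: "\<phi> \<one> = \<one>" using pair[of \<one>] by (simp add: inv_pair_def)
  have \<phi>inv: "\<phi> (inv y) = inv (\<phi> y)" if "y \<in> carrier G" for y
  proof (rule right_inverse_eq)
    show "\<one> = \<phi> y \<otimes> \<phi> (inv y)" using hom[of y "inv y"] that one by simp
  qed (use c that in auto)
  have invol: "\<phi> (\<phi> y) = y" if "y \<in> carrier G" for y
    using pair[OF that] \<phi>inv[OF that] that by (auto simp: inv_pair_def)
  have ff: "f (f y) = y" if "y \<in> carrier G" for y using invol c that by (simp add: f_def)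
  have "bij_betw f (carrier G) (carrier G)"
    by (rule bij_betw_byWitness[where f' = f]) (use ff c in \<open>auto simp: f_def\<close>)
  then have fB: "f \<in> Bij (carrier G)" by (simp add: Bij_def f_def)
  have edge: "f ` e \<in> cayley_edges G S" if "e \<in> cayley_edges G S" for e
  proof -
    obtain r t where e: "e = {r, t}" "r \<in> carrier G" "t \<in> carrier G" "t \<otimes> inv r \<in> S"
      using \<open>e \<in> cayley_edges G S\<close> by (auto simp: cayley_edges_def)
    have "\<phi> t \<otimes> inv (\<phi> r) = \<phi> (t \<otimes> inv r)" using hom \<phi>inv e by simp
    moreover have "\<phi> (t \<otimes> inv r) \<in> S"
      using pair[of "t \<otimes> inv r"] e set_inv_self_iff[OF S, of "t \<otimes> inv r"] by (auto simp: inv_pair_def)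
    ultimately have "{\<phi> r, \<phi> t} \<in> cayley_edges G S" using cayley_edge_iff[OF S] c e by simp
    then show ?thesis using e by (simp add: f_def)
  qed
  have "cayley_edges G S \<subseteq> (\<lambda>e. f ` e) ` cayley_edges G S"
  proof
    fix e assume e: "e \<in> cayley_edges G S"
    then have "e \<subseteq> carrier G" by (auto simp: cayley_edges_def)
    then have "(\<lambda>y. f (f y)) ` e = (\<lambda>y. y) ` e" using ff by (intro image_cong) auto
    then have "e = f ` f ` e" by (simp add: image_image)
    then show "e \<in> (\<lambda>e. f ` e) ` cayley_edges G S" using edge[OF e] by (rule image_eqI)
  qed
  then have fK: "f \<in> carrier ?K" using fB edge by (auto simp: carrier_cayley_aut)
  have mult: "a \<otimes>\<^bsub>?K\<^esub> b = compose (carrier G) a b"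
    if "a \<in> Bij (carrier G)" "b \<in> Bij (carrier G)" for a b
    using that by (simp add: cayley_aut_def BijGroup_def)
  have oneK: "\<one>\<^bsub>?K\<^esub> = (\<lambda>x\<in>carrier G. x)" by (simp add: cayley_aut_def BijGroup_def)
  have ffid: "compose (carrier G) f f = (\<lambda>x\<in>carrier G. x)"
    using ff by (auto simp: compose_def fun_eq_iff)
  \<comment> \<open>The inverse is identified from its defining description: any candidate
    \<open>g\<close> satisfies \<open>f (g x) = x\<close>, and applying \<open>f\<close> once more
    gives \<open>g x = f x\<close>.\<close>
  have invf: "inv\<^bsub>?K\<^esub> f = f"
    unfolding m_inv_def
  proof (rule the_equality)
    show "f \<in> carrier ?K \<and> f \<otimes>\<^bsub>?K\<^esub> f = \<one>\<^bsub>?K\<^esub> \<and> f \<otimes>\<^bsub>?K\<^esub> f = \<one>\<^bsub>?K\<^esub>"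
      using fK fB mult oneK ffid by simp
    fix g assume g: "g \<in> carrier ?K \<and> f \<otimes>\<^bsub>?K\<^esub> g = \<one>\<^bsub>?K\<^esub> \<and> g \<otimes>\<^bsub>?K\<^esub> f = \<one>\<^bsub>?K\<^esub>"
    then have gB: "g \<in> Bij (carrier G)" by (simp add: carrier_cayley_aut)
    have fg: "compose (carrier G) f g = (\<lambda>x\<in>carrier G. x)" using g mult[OF fB gB] oneK by simp
    show "g = f"
    proof (rule extensionalityI[of _ "carrier G"])
      fix x assume x: "x \<in> carrier G"
      then have "f (g x) = x" using fun_cong[OF fg, of x] by (simp add: compose_eq)
      moreover have "g x \<in> carrier G" using Bij_imp_funcset[OF gB] x by auto
      ultimately show "g x = f x" using ff by metis
    qed (use gB fB in \<open>auto simp: Bij_def\<close>)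
  qed
  have conj: "f \<otimes>\<^bsub>?K\<^esub> \<rho> h \<otimes>\<^bsub>?K\<^esub> f = \<rho> (\<phi> h)" if h: "h \<in> carrier G" for h
  proof -
    have "f \<otimes>\<^bsub>?K\<^esub> \<rho> h \<otimes>\<^bsub>?K\<^esub> f = compose (carrier G) (compose (carrier G) f (\<rho> h)) f"
      unfolding mult[OF fB HB[OF h]] by (rule mult[OF compose_Bij[OF fB HB[OF h]] fB])
    also have "\<dots> = \<rho> (\<phi> h)"
    proof (rule extensionalityI[of _ "carrier G"])
      fix x assume x: "x \<in> carrier G"
      then show "compose (carrier G) (compose (carrier G) f (\<rho> h)) f x = \<rho> (\<phi> h) x"
        using h c hom invol by (simp add: compose_eq f_def \<rho>_def)
    qed (auto simp: \<rho>_def compose_def)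
    finally show ?thesis .
  qed
  \<comment> \<open>Conjugation by \<open>f\<close> turns right multiplication by \<open>h\<close>
    into right multiplication by \<open>\<phi> h\<close>, and \<open>\<phi>\<close> permutes the
    carrier.\<close>
  have "f <#\<^bsub>?K\<^esub> ?H #>\<^bsub>?K\<^esub> inv\<^bsub>?K\<^esub> f = (\<lambda>h. \<rho> (\<phi> h)) ` carrier G"
    unfolding invf H l_coset_def r_coset_def using conj by auto
  also have "\<dots> = ?H"
    unfolding H using invol c by (force simp: image_iff)
  finally have "f \<in> normalizer ?K ?H"
    using HK fK by (simp add: normalizer_def stabilizer_def)
  then have "f \<in> ?H" by (rule subsetD[OF equalityD2[OF eq]])
  \<comment> \<open>A right multiplication that fixes the identity is the identity map, but
    \<open>f\<close> moves \<open>z\<close>.\<close>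
  then obtain h where h: "h \<in> carrier G" "f = \<rho> h" unfolding H by blast
  have "f \<one> = h" using h by (simp add: \<rho>_def)
  then have "h = \<one>" using one by (simp add: f_def)
  then have "f z = z" using h moves by (simp add: \<rho>_def)
  then show False using moves by (simp add: f_def)
qed

text \<open>As \<open>H\<close> is abelian and its complement is the coset of \<open>x\<close>, what
  holds for \<open>x\<close> passes to every \<open>u\<close> outside \<open>H\<close>. The square
  of \<open>x\<close> lies in \<open>H\<close>, so \<open>x\<close> both inverts it and commutes
  with it, whence the fourth power of \<open>x\<close> is trivial.\<close>

lemma inverted_halfD:
  assumes "inverted_half H"
  obtains x where "subgroup H G" "\<And>a b. a \<in> H \<Longrightarrow> b \<in> H \<Longrightarrow> a \<otimes> b = b \<otimes> a"
    "\<exists>v\<in>H. v \<otimes> v \<noteq> \<one>" "x \<in> carrier G" "x \<notin> H" "x \<otimes> x \<in> H" "x \<otimes> x \<noteq> \<one>"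
    "x \<otimes> x \<otimes> (x \<otimes> x) = \<one>"
    "\<And>u. u \<in> carrier G \<Longrightarrow> u \<notin> H \<Longrightarrow> u \<otimes> inv x \<in> H"
    "\<And>u h. u \<in> carrier G \<Longrightarrow> u \<notin> H \<Longrightarrow> h \<in> H \<Longrightarrow> u \<otimes> h = inv h \<otimes> u"
proof -
  obtain x where x: "x \<in> carrier G" "x \<notin> H" "x \<otimes> x \<noteq> \<one>" and comp: "carrier G - H = (\<lambda>h. x \<otimes> h) ` H"
    and xinv: "\<And>h. h \<in> H \<Longrightarrow> x \<otimes> h = inv h \<otimes> x"
    using assms unfolding inverted_half_def by blast
  have H: "subgroup H G" and ab: "\<And>a b. a \<in> H \<Longrightarrow> b \<in> H \<Longrightarrow> a \<otimes> b = b \<otimes> a"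
    and v: "\<exists>v\<in>H. v \<otimes> v \<noteq> \<one>"
    using assms by (auto simp: inverted_half_def)
  have HC: "h \<in> carrier G" if "h \<in> H" for h using subgroup.subset[OF H] that by auto
  have iH: "inv h \<in> H" if "h \<in> H" for h using H that by (simp add: subgroup.m_inv_closed)
  have w: "x \<otimes> x \<in> H"
  proof (rule ccontr)
    assume "x \<otimes> x \<notin> H"
    then obtain h where "h \<in> H" "x \<otimes> x = x \<otimes> h" using comp x by blast
    then have "x = h" using x HC by simp
    then show False using \<open>h \<in> H\<close> x by simp
  qed
  have u1: "u \<otimes> inv x \<in> H" if u: "u \<in> carrier G" "u \<notin> H" for u
  proof -
    obtain h where h: "h \<in> H" "u = x \<otimes> h" using comp u by blast
    then have "u \<otimes> inv x = inv h" using xinv[OF h(1)] HC[OF h(1)] x by (simp add: m_assoc)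
    then show ?thesis using iH h by simp
  qed
  have u2: "u \<otimes> h = inv h \<otimes> u" if u: "u \<in> carrier G" "u \<notin> H" and h: "h \<in> H" for u h
  proof -
    obtain k where k: "k \<in> H" "u = x \<otimes> k" using comp u by blast
    have "u \<otimes> h = x \<otimes> (k \<otimes> h)" using k HC h x by (simp add: m_assoc)
    also have "k \<otimes> h = h \<otimes> k" using ab k h by simp
    also have "x \<otimes> (h \<otimes> k) = x \<otimes> h \<otimes> k" using k HC h x by (simp add: m_assoc)
    also have "x \<otimes> h = inv h \<otimes> x" using xinv h by simp
    finally show ?thesis using k HC h x by (simp add: m_assoc)
  qed
  have "x \<otimes> (x \<otimes> x) = inv (x \<otimes> x) \<otimes> x" using xinv[OF w] .
  then have "x \<otimes> (x \<otimes> x) \<otimes> x = inv (x \<otimes> x) \<otimes> x \<otimes> x" by simp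
  then have "x \<otimes> x \<otimes> (x \<otimes> x) = \<one>" using x by (simp add: m_assoc)
  then show thesis by (intro that[OF H ab v x(1,2) w x(3) _ u1 u2])
qed

text \<open>\<open>\<phi>\<close> is the identity on \<open>H\<close> and inversion outside. All
  elements outside \<open>H\<close> have the same square \<open>?w\<close>, a central involution, so
  inversion there is multiplication by \<open>?w\<close>. Thus \<open>\<phi>\<close> multiplies each
  element by its image under the homomorphism onto \<open>{\<one>, ?w}\<close> with kernel
  \<open>H\<close>.\<close>

lemma inverted_half_automorphism:
  assumes "inverted_half H"
  obtains \<phi> z where "\<And>a b. a \<in> carrier G \<Longrightarrow> b \<in> carrier G \<Longrightarrow> \<phi> (a \<otimes> b) = \<phi> a \<otimes> \<phi> b"
    "\<And>y. y \<in> carrier G \<Longrightarrow> \<phi> y \<in> inv_pair y" "z \<in> carrier G" "\<phi> z \<noteq> z"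
proof -
  obtain x where H: "subgroup H G" and ab: "\<And>a b. a \<in> H \<Longrightarrow> b \<in> H \<Longrightarrow> a \<otimes> b = b \<otimes> a"
    and x: "x \<in> carrier G" "x \<notin> H" and w: "x \<otimes> x \<in> H" "x \<otimes> x \<noteq> \<one>" "x \<otimes> x \<otimes> (x \<otimes> x) = \<one>"
    and u1: "\<And>u. u \<in> carrier G \<Longrightarrow> u \<notin> H \<Longrightarrow> u \<otimes> inv x \<in> H"
    and u2: "\<And>u h. u \<in> carrier G \<Longrightarrow> u \<notin> H \<Longrightarrow> h \<in> H \<Longrightarrow> u \<otimes> h = inv h \<otimes> u"
    using inverted_halfD[OF assms] by metis
  have HC: "h \<in> carrier G" if "h \<in> H" for h using subgroup.subset[OF H] that by auto
  have iH: "inv h \<in> H" if "h \<in> H" for h using H that by (simp add: subgroup.m_inv_closed)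
  have mH: "h \<otimes> k \<in> H" if "h \<in> H" "k \<in> H" for h k using H that by (simp add: subgroup.m_closed)
  have hu: "h \<otimes> u \<notin> H" if "h \<in> H" "u \<in> carrier G" "u \<notin> H" for h u
  proof
    assume "h \<otimes> u \<in> H"
    then have "inv h \<otimes> (h \<otimes> u) \<in> H" using mH iH that by blast
    then show False using that HC by (simp add: inv_mult_cancel)
  qed
  have uh: "u \<otimes> h \<notin> H" if "h \<in> H" "u \<in> carrier G" "u \<notin> H" for h u
    using hu[OF iH[OF that(1)] that(2,3)] u2[OF that(2,3,1)] by simp
  let ?w = "x \<otimes> x"
  have iw: "inv ?w = ?w" using w x inv_equality by blast
  have sq: "u \<otimes> u = ?w" if u: "u \<in> carrier G" "u \<notin> H" for u
  proof -
    define k where "k = u \<otimes> inv x"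
    have k: "k \<in> H" "u = k \<otimes> x" using u1[OF u] u x by (auto simp: k_def m_assoc)
    have "u \<otimes> u = k \<otimes> (x \<otimes> k) \<otimes> x" using k HC x by (simp add: m_assoc)
    also have "x \<otimes> k = inv k \<otimes> x" using u2 x k by simp
    finally show ?thesis using k HC x by (simp add: group_norm)
  qed
  have uv: "u \<otimes> v \<in> H" if "u \<in> carrier G" "u \<notin> H" "v \<in> carrier G" "v \<notin> H" for u v
  proof -
    define h where "h = u \<otimes> inv x"
    define k where "k = v \<otimes> inv x"
    have h: "h \<in> H" "u = h \<otimes> x" and k: "k \<in> H" "v = k \<otimes> x"
      using u1 that x by (auto simp: h_def k_def m_assoc)
    have "u \<otimes> v = h \<otimes> (x \<otimes> k) \<otimes> x" using h k HC x by (simp add: m_assoc)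
    also have "x \<otimes> k = inv k \<otimes> x" using u2 x k by simp
    finally have "u \<otimes> v = h \<otimes> inv k \<otimes> ?w" using h k HC x by (simp add: m_assoc)
    then show ?thesis using h k mH iH w by simp
  qed
  have uinv: "inv u = u \<otimes> ?w" if u: "u \<in> carrier G" "u \<notin> H" for u
  proof -
    have "u \<otimes> (u \<otimes> ?w) = (u \<otimes> u) \<otimes> ?w" using u x by (simp add: m_assoc)
    then have "\<one> = u \<otimes> (u \<otimes> ?w)" using sq[OF u] w by simp
    then have "u \<otimes> ?w = inv u" using right_inverse_eq[of u "u \<otimes> ?w"] u x by simp
    then show ?thesis by simp
  qed
  define \<phi> where "\<phi> = (\<lambda>y. if y \<in> H then y else inv y)"
  have hom: "\<phi> (a \<otimes> b) = \<phi> a \<otimes> \<phi> b" if a: "a \<in> carrier G" and b: "b \<in> carrier G" for a b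
  proof (cases "a \<in> H"; cases "b \<in> H")
    assume "a \<in> H" "b \<in> H" then show ?thesis by (simp add: \<phi>_def mH)
  next
    assume h: "a \<in> H" "b \<notin> H"
    have "inv (a \<otimes> b) = a \<otimes> b \<otimes> ?w" using uinv[of "a \<otimes> b"] hu[OF h(1) b h(2)] a b by simp
    then show ?thesis using h hu[OF h(1) b h(2)] uinv[OF b h(2)] a b x by (simp add: \<phi>_def m_assoc)
  next
    assume h: "a \<notin> H" "b \<in> H"
    have "inv (a \<otimes> b) = a \<otimes> (b \<otimes> ?w)"
      using uinv[of "a \<otimes> b"] uh[OF h(2) a h(1)] a b x by (simp add: m_assoc)
    also have "\<dots> = a \<otimes> (?w \<otimes> b)" using ab[OF h(2) w(1)] by simp
    finally show ?thesis using h uh[OF h(2) a h(1)] uinv[OF a h(1)] a b x by (simp add: \<phi>_def m_assoc)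
  next
    assume h: "a \<notin> H" "b \<notin> H"
    have "?w \<otimes> b = b \<otimes> ?w" using u2[OF b h(2) w(1)] iw by simp
    then have "a \<otimes> ?w \<otimes> (b \<otimes> ?w) = a \<otimes> b \<otimes> (?w \<otimes> ?w)" using a b x by (metis m_assoc m_closed)
    then have "inv a \<otimes> inv b = a \<otimes> b" using uinv h a b w by simp
    then show ?thesis using h uv[OF a h(1) b h(2)] by (simp add: \<phi>_def)
  qed
  have "\<phi> x \<noteq> x"
  proof
    assume "\<phi> x = x"
    then have "inv x = x" using x by (simp add: \<phi>_def)
    then show False using w x by (metis r_inv)
  qed
  moreover have "\<phi> y \<in> inv_pair y" for y by (simp add: \<phi>_def inv_pair_def)
  ultimately show thesis using that[of \<phi> x] hom x by simp
qed

end


section \<open>Presented groups\<close>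

lemma gwords_append [simp]: "u @ v \<in> gwords X \<longleftrightarrow> u \<in> gwords X \<and> v \<in> gwords X"
  by (auto simp: gwords_def)

lemma gwords_Nil [simp]: "[] \<in> gwords X" by (simp add: gwords_def)

lemma gwords_Cons [simp]: "l # v \<in> gwords X \<longleftrightarrow> fst l \<in> X \<and> v \<in> gwords X"
  by (cases l) (auto simp: gwords_def)

locale presentation =
  fixes X :: "'g set" and \<R> :: "('g gword \<times> 'g gword) set"
  assumes relations: "\<R> \<subseteq> gwords X \<times> gwords X"
begin

abbreviation "P \<equiv> presented_group X \<R>"

definition cls :: "'g gword \<Rightarrow> 'g gword set" where
  "cls u = pres_cong X \<R> `` {u}"

lemma step_context:
  assumes "(u, v) \<in> pres_step X \<R>" "a \<in> gwords X" "b \<in> gwords X"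
  shows "(a @ u @ b, a @ v @ b) \<in> pres_step X \<R>"
proof -
  obtain p q l r where "u = p @ l @ q" "v = p @ r @ q" "p \<in> gwords X" "q \<in> gwords X"
    and lr: "(l, r) \<in> \<R> \<union> {([(g, b), (g, \<not> b)], []) | g b. g \<in> X}"
    using assms(1) unfolding pres_step_def by blast
  then have "a @ u @ b = (a @ p) @ l @ (q @ b)" "a @ v @ b = (a @ p) @ r @ (q @ b)"
    "a @ p \<in> gwords X" "q @ b \<in> gwords X" using assms by auto
  then show ?thesis using lr unfolding pres_step_def by blast
qed

lemma equiv_cong: "equiv (gwords X) (pres_cong X \<R>)"
proof (rule equivI)
  let ?s = "pres_step X \<R> \<union> (pres_step X \<R>)\<inverse>"
  have "sym (?s\<^sup>*)" by (intro sym_rtrancl) (auto simp: sym_def)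
  then show "sym (pres_cong X \<R>)" by (auto simp: pres_cong_def sym_def)
  show "trans (pres_cong X \<R>)"
    unfolding pres_cong_def by (auto simp: trans_def intro: rtrancl_trans)
  show "refl_on (gwords X) (pres_cong X \<R>)" by (auto simp: pres_cong_def refl_on_def)
  show "pres_cong X \<R> \<subseteq> gwords X \<times> gwords X" by (auto simp: pres_cong_def)
qed

lemma cong_context:
  assumes "(u, v) \<in> pres_cong X \<R>" "a \<in> gwords X" "b \<in> gwords X"
  shows "(a @ u @ b, a @ v @ b) \<in> pres_cong X \<R>"
proof -
  let ?s = "pres_step X \<R> \<union> (pres_step X \<R>)\<inverse>"
  have "(u, v) \<in> ?s\<^sup>*" using assms by (simp add: pres_cong_def)
  then have "(a @ u @ b, a @ v @ b) \<in> ?s\<^sup>*"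
  proof (induction rule: rtrancl_induct)
    case (step y z)
    then have "(a @ y @ b, a @ z @ b) \<in> ?s" using step_context assms by blast
    then show ?case using step.IH by (rule rtrancl_into_rtrancl[rotated])
  qed simp
  then show ?thesis using assms by (auto simp: pres_cong_def)
qed

lemma cls_eq_iff: "u \<in> gwords X \<Longrightarrow> v \<in> gwords X \<Longrightarrow> cls u = cls v \<longleftrightarrow> (u, v) \<in> pres_cong X \<R>"
  unfolding cls_def using eq_equiv_class_iff[OF equiv_cong] by blast

lemma carrier_presented: "carrier P = cls ` gwords X"
  by (auto simp: presented_group_def quotient_def cls_def)

lemma one_presented: "\<one>\<^bsub>P\<^esub> = cls []"
  by (simp add: presented_group_def cls_def)

text \<open>The product is a union over representatives; by \<open>cong_context\<close> replacing
  either factor by a congruent word keeps the class, so all members of the union coincide.\<close>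

lemma mult_cls:
  assumes u: "u \<in> gwords X" and v: "v \<in> gwords X"
  shows "cls u \<otimes>\<^bsub>P\<^esub> cls v = cls (u @ v)"
proof -
  have "cls (u' @ v') = cls (u @ v)" if "u' \<in> cls u" "v' \<in> cls v" for u' v'
  proof -
    have uu: "(u, u') \<in> pres_cong X \<R>" and vv: "(v, v') \<in> pres_cong X \<R>"
      using that by (auto simp: cls_def)
    then have g: "u' \<in> gwords X" "v' \<in> gwords X" by (auto simp: pres_cong_def)
    have "cls (u @ v) = cls (u' @ v)"
      using cong_context[OF uu, of "[]" v] u v g by (simp add: cls_eq_iff)
    also have "\<dots> = cls (u' @ v')"
      using cong_context[OF vv, of u' "[]"] u v g by (simp add: cls_eq_iff)
    finally show ?thesis by simp
  qed
  moreover have "u \<in> cls u" "v \<in> cls v"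
    using u v equiv_class_self[OF equiv_cong] by (auto simp: cls_def)
  ultimately have "(\<Union>u'\<in>cls u. \<Union>v'\<in>cls v. cls (u' @ v')) = cls (u @ v)" by blast
  then show ?thesis by (simp add: presented_group_def cls_def)
qed

lemma cls_relation:
  assumes "(l, r) \<in> \<R>"
  shows "cls l = cls r"
proof -
  have g: "l \<in> gwords X" "r \<in> gwords X" using assms relations by auto
  have "([] @ l @ [], [] @ r @ []) \<in> pres_step X \<R>"
    unfolding pres_step_def using assms gwords_Nil by blast
  then show ?thesis using g by (auto simp: cls_eq_iff pres_cong_def)
qed

lemma cls_cancel:
  assumes "g \<in> X"
  shows "cls [(g, b), (g, \<not> b)] = cls []"
proof -
  have "([] @ [(g, b), (g, \<not> b)] @ [], [] @ [] @ []) \<in> pres_step X \<R>"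
    unfolding pres_step_def using assms gwords_Nil by blast
  then show ?thesis using assms by (auto simp: cls_eq_iff pres_cong_def)
qed

lemma group_presented: "group P"
proof (rule groupI)
  show "x \<otimes>\<^bsub>P\<^esub> y \<in> carrier P" if "x \<in> carrier P" "y \<in> carrier P" for x y
    using that by (auto simp: carrier_presented mult_cls)
  show "\<one>\<^bsub>P\<^esub> \<in> carrier P" by (auto simp: carrier_presented one_presented)
  show "x \<otimes>\<^bsub>P\<^esub> y \<otimes>\<^bsub>P\<^esub> z = x \<otimes>\<^bsub>P\<^esub> (y \<otimes>\<^bsub>P\<^esub> z)"
    if "x \<in> carrier P" "y \<in> carrier P" "z \<in> carrier P" for x y z
    using that by (auto simp: carrier_presented mult_cls)
  show "\<one>\<^bsub>P\<^esub> \<otimes>\<^bsub>P\<^esub> x = x" if "x \<in> carrier P" for x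
    using that by (auto simp: carrier_presented one_presented mult_cls)
  show "\<exists>y\<in>carrier P. y \<otimes>\<^bsub>P\<^esub> x = \<one>\<^bsub>P\<^esub>" if xP: "x \<in> carrier P" for x
  proof -
    obtain w where w: "w \<in> gwords X" "x = cls w" using xP by (auto simp: carrier_presented)
    \<comment> \<open>A left inverse of \<open>l # w\<close> is a left inverse of \<open>w\<close>
      followed by the inverted letter, which cancels against \<open>l\<close>.\<close>
    have "\<exists>v\<in>gwords X. cls (v @ w) = cls []" using w(1)
    proof (induction w)
      case Nil
      then show ?case by (intro bexI[of _ "[]"]) auto
    next
      case (Cons l w)
      obtain g b where l: "l = (g, b)" by force
      have g: "g \<in> X" and w: "w \<in> gwords X" using Cons.prems by (auto simp: l)
      obtain v where v: "v \<in> gwords X" "cls (v @ w) = cls []" using Cons.IH[OF w] by blast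
      have "([(g, \<not> b), (g, b)], []) \<in> pres_cong X \<R>"
        using cls_cancel[OF g, of "\<not> b"] g by (simp add: cls_eq_iff)
      then have "(v @ [(g, \<not> b), (g, b)] @ w, v @ [] @ w) \<in> pres_cong X \<R>"
        using v(1) w by (rule cong_context)
      then have "cls ((v @ [(g, \<not> b)]) @ l # w) = cls []"
        using v w g by (simp add: cls_eq_iff[symmetric] l)
      then show ?case using v(1) g by (intro bexI[of _ "v @ [(g, \<not> b)]"]) auto
    qed
    then show ?thesis using w by (auto simp: carrier_presented one_presented mult_cls)
  qed
qed

lemma cls_letter_inverse:
  assumes "g \<in> X"
  shows "cls [(g, False)] = inv\<^bsub>P\<^esub> cls [(g, True)]"
proof -
  interpret P: group P by (rule group_presented)
  show ?thesis
  proof (rule P.inv_equality[symmetric])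
    show "cls [(g, False)] \<otimes>\<^bsub>P\<^esub> cls [(g, True)] = \<one>\<^bsub>P\<^esub>"
      using cls_cancel[OF assms, of False] assms by (simp add: mult_cls one_presented)
  qed (use assms in \<open>auto simp: carrier_presented\<close>)
qed

end

section \<open>Word evaluation and the dicyclic presentation\<close>

context group
begin

fun eval_word :: "('g \<times> bool \<Rightarrow> 'a) \<Rightarrow> 'g gword \<Rightarrow> 'a" where
  "eval_word e [] = \<one>"
| "eval_word e (l # w) = e l \<otimes> eval_word e w"

lemma eval_word_closed:
  "(\<And>l. fst l \<in> X \<Longrightarrow> e l \<in> carrier G) \<Longrightarrow> w \<in> gwords X \<Longrightarrow> eval_word e w \<in> carrier G"
  by (induction w) auto

lemma eval_word_append:
  "(\<And>l. fst l \<in> X \<Longrightarrow> e l \<in> carrier G) \<Longrightarrow> u \<in> gwords X \<Longrightarrow> v \<in> gwords X \<Longrightarrow>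
    eval_word e (u @ v) = eval_word e u \<otimes> eval_word e v"
  using eval_word_closed[of X e] by (induction u) (auto simp: m_assoc)

text \<open>The word form of von Dyck's theorem: each elementary step replaces a subword by one of
  equal value. As \<open>e\<close> assigns values to signed letters, its compatibility with formal
  inverses is a separate hypothesis.\<close>

lemma eval_word_cong:
  assumes R: "\<R> \<subseteq> gwords X \<times> gwords X"
    and e: "\<And>l. fst l \<in> X \<Longrightarrow> e l \<in> carrier G"
    and einv: "\<And>g b. g \<in> X \<Longrightarrow> e (g, b) \<otimes> e (g, \<not> b) = \<one>"
    and rel: "\<And>l r. (l, r) \<in> \<R> \<Longrightarrow> eval_word e l = eval_word e r"
    and uv: "(u, v) \<in> pres_cong X \<R>"
  shows "eval_word e u = eval_word e v"
proof -
  have step: "eval_word e y = eval_word e z" if "(y, z) \<in> pres_step X \<R>" for y z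
  proof -
    obtain p q l r where yz: "y = p @ l @ q" "z = p @ r @ q" "p \<in> gwords X" "q \<in> gwords X"
      and lr: "(l, r) \<in> \<R> \<union> {([(g, b), (g, \<not> b)], []) | g b. g \<in> X}"
      using \<open>(y, z) \<in> pres_step X \<R>\<close> unfolding pres_step_def by blast
    have "eval_word e l = eval_word e r \<and> l \<in> gwords X \<and> r \<in> gwords X"
      using lr
    proof
      assume "(l, r) \<in> {([(g, b), (g, \<not> b)], []) | g b. g \<in> X}"
      then show ?thesis using einv e by auto
    qed (use rel R in auto)
    then show ?thesis using yz by (simp add: eval_word_append[OF e])
  qed
  have "(u, v) \<in> (pres_step X \<R> \<union> (pres_step X \<R>)\<inverse>)\<^sup>*" using uv by (simp add: pres_cong_def)
  then show ?thesis
  proof (induction rule: rtrancl_induct)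
    case (step y z)
    then show ?case using \<open>\<And>z y. (y, z) \<in> pres_step X \<R> \<Longrightarrow> eval_word e y = eval_word e z\<close> by fastforce
  qed simp
qed

text \<open>The group order shows that the minimum is attained, so the exponent annihilates every
  element; \<open>v\<close> then rules out 1 and 2.\<close>

lemma group_exponent_gt_two:
  assumes fin: "finite (carrier G)" and v: "v \<in> carrier G" "v \<otimes> v \<noteq> \<one>"
  shows "group_exponent G > 2"
proof -
  let ?Q = "\<lambda>n. 0 < n \<and> (\<forall>a\<in>carrier G. a [^] n = \<one>)"
  have "?Q (order G)"
    using pow_order_eq_1 order_gt_0_iff_finite fin by auto
  then have Q: "?Q (group_exponent G)" unfolding group_exponent_def by (rule LeastI)
  have "group_exponent G \<noteq> 1"
  proof
    assume "group_exponent G = 1"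
    then have "v = \<one>" using Q v by auto
    then show False using v by simp
  qed
  moreover have "group_exponent G \<noteq> 2" using Q v by (auto simp: numeral_2_eq_2)
  ultimately show ?thesis using Q by linarith
qed

text \<open>Every element is \<open>h\<close> or \<open>h \<otimes> x\<close> with \<open>h\<close>
  in \<open>H\<close>, and \<open>\<psi>\<close> sends it to the class of the corresponding word.
  The relations make \<open>\<psi>\<close> multiplicative, its image contains all generators, and
  evaluating words back in the group shows that it is injective.\<close>

lemma generalised_dicyclic_if_inverted_half:
  fixes H :: "'a set"
  assumes fin: "finite (carrier G)" and half: "inverted_half H"
  shows "generalised_dicyclic G"
proof -
  obtain x where H: "subgroup H G" and ab: "\<And>a b. a \<in> H \<Longrightarrow> b \<in> H \<Longrightarrow> a \<otimes> b = b \<otimes> a"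
    and ex: "\<exists>v\<in>H. v \<otimes> v \<noteq> \<one>"
    and x: "x \<in> carrier G" "x \<notin> H" and w: "x \<otimes> x \<in> H" "x \<otimes> x \<noteq> \<one>" "x \<otimes> x \<otimes> (x \<otimes> x) = \<one>"
    and u1: "\<And>u. u \<in> carrier G \<Longrightarrow> u \<notin> H \<Longrightarrow> u \<otimes> inv x \<in> H"
    and u2: "\<And>u h. u \<in> carrier G \<Longrightarrow> u \<notin> H \<Longrightarrow> h \<in> H \<Longrightarrow> u \<otimes> h = inv h \<otimes> u"
    using inverted_halfD[OF half] by metis
  have HC: "h \<in> carrier G" if "h \<in> H" for h using subgroup.subset[OF H] that by auto
  have iH: "inv h \<in> H" if "h \<in> H" for h using H that by (simp add: subgroup.m_inv_closed)
  have mH: "h \<otimes> k \<in> H" if "h \<in> H" "k \<in> H" for h k using H that by (simp add: subgroup.m_closed)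
  have oH: "\<one> \<in> H" using H by (simp add: subgroup.one_closed)
  have fH: "finite H" by (rule finite_subset[OF subgroup.subset[OF H] fin])
  define A :: "'a monoid" where "A = \<lparr>carrier = H, monoid.mult = (\<otimes>), one = \<one>\<rparr>"
  have A: "carrier A = H" "\<And>a b. a \<otimes>\<^bsub>A\<^esub> b = a \<otimes> b" "\<one>\<^bsub>A\<^esub> = \<one>" by (auto simp: A_def)
  have cA: "comm_group A"
  proof (rule comm_groupI)
    show "\<exists>y\<in>carrier A. y \<otimes>\<^bsub>A\<^esub> a = \<one>\<^bsub>A\<^esub>" if "a \<in> carrier A" for a
      using that iH HC unfolding A by (intro bexI[of _ "inv a"]) auto
    show "a \<otimes>\<^bsub>A\<^esub> b = b \<otimes>\<^bsub>A\<^esub> a" if "a \<in> carrier A" "b \<in> carrier A" for a b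
      using that ab by (simp add: A)
  qed (use HC mH oH in \<open>auto simp: A m_assoc\<close>)
  interpret A: comm_group A by (rule cA)
  \<comment> \<open>The square of \<open>x\<close> is the required involution; Lagrange's theorem
    then makes the order of \<open>A\<close> even.\<close>
  let ?y = "x \<otimes> x"
  have sqA: "a [^]\<^bsub>A\<^esub> (2::nat) = a \<otimes> a" if "a \<in> H" for a
    using that HC by (simp add: numeral_2_eq_2 A)
  have ordy: "A.ord ?y = 2"
  proof -
    have "?y [^]\<^bsub>A\<^esub> (2::nat) = \<one>\<^bsub>A\<^esub>" using sqA w A by simp
    then have "A.ord ?y dvd 2" using A.pow_eq_id[of ?y 2] w A by simp
    moreover have "A.ord ?y \<noteq> 1" using A.ord_eq_1[of ?y] w A by simp
    moreover have "A.ord ?y \<noteq> 0" using \<open>A.ord ?y dvd 2\<close> by (metis dvd_0_left zero_neq_numeral)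
    ultimately show ?thesis using dvd_imp_le[of "A.ord ?y" 2] by linarith
  qed
  have evenA: "even (order A)"
    using A.ord_dvd_group_order[of ?y] ordy w A by simp
  have expA: "group_exponent A > 2"
    using A.group_exponent_gt_two ex fH A by auto
  define X where "X = insert None (Some ` carrier A)"
  define \<R> where "\<R> = dic_relations A ?y"
  have XS: "Some a \<in> X" if "a \<in> H" for a using that A by (auto simp: X_def)
  have XN: "None \<in> X" by (simp add: X_def)
  interpret P: presentation X \<R>
  proof
    show "\<R> \<subseteq> gwords X \<times> gwords X"
      using w mH XS XN A by (auto simp: \<R>_def dic_relations_def)
  qed
  interpret PG: group "presented_group X \<R>" by (rule P.group_presented)
  have dic: "dic_group A ?y = presented_group X \<R>" by (simp add: dic_group_def X_def \<R>_def)
  let ?P = "presented_group X \<R>"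
  define \<alpha> where "\<alpha> = (\<lambda>a. P.cls [(Some a, True)])"
  define \<xi> where "\<xi> = P.cls [(None, True)]"
  have \<alpha>c: "\<alpha> a \<in> carrier ?P" if "a \<in> H" for a
    using XS[OF that] by (auto simp: \<alpha>_def P.carrier_presented)
  have \<xi>c: "\<xi> \<in> carrier ?P" using XN by (auto simp: \<xi>_def P.carrier_presented)
  have \<alpha>m: "\<alpha> (a \<otimes> b) = \<alpha> a \<otimes>\<^bsub>?P\<^esub> \<alpha> b" if "a \<in> H" "b \<in> H" for a b
  proof -
    have "([(Some a, True), (Some b, True)], [(Some (a \<otimes> b), True)]) \<in> \<R>"
      using that A by (auto simp: \<R>_def dic_relations_def)
    then show ?thesis using P.cls_relation XS that by (simp add: \<alpha>_def P.mult_cls)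
  qed
  have \<alpha>1: "\<alpha> \<one> = \<one>\<^bsub>?P\<^esub>"
    using \<alpha>m[OF oH oH] \<alpha>c[OF oH] by (simp add: PG.l_cancel_one')
  have \<alpha>i: "\<alpha> (inv a) = inv\<^bsub>?P\<^esub> \<alpha> a" if "a \<in> H" for a
    using \<alpha>m[OF iH[OF that] that] \<alpha>1 \<alpha>c iH that HC by (intro PG.inv_equality[symmetric]) auto
  have \<xi>2: "\<xi> \<otimes>\<^bsub>?P\<^esub> \<xi> = \<alpha> ?y"
  proof -
    have "([(None, True), (None, True)], [(Some ?y, True)]) \<in> \<R>"
      by (auto simp: \<R>_def dic_relations_def)
    then show ?thesis using P.cls_relation XN by (simp add: \<alpha>_def \<xi>_def P.mult_cls)
  qed
  \<comment> \<open>The conjugation relation is used for \<open>inv a\<close>: its right-hand side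
    is the inverse of \<open>\<alpha> (inv a)\<close>, that is \<open>\<alpha> a\<close>, and
    \<open>\<xi>\<close> moves to the other side.\<close>
  have \<xi>\<alpha>: "\<xi> \<otimes>\<^bsub>?P\<^esub> \<alpha> a = \<alpha> (inv a) \<otimes>\<^bsub>?P\<^esub> \<xi>" if a: "a \<in> H" for a
  proof -
    have "([(None, False), (Some (inv a), True), (None, True)], [(Some (inv a), False)]) \<in> \<R>"
      using iH[OF a] A by (auto simp: \<R>_def dic_relations_def)
    then have "P.cls [(None, False), (Some (inv a), True), (None, True)] = P.cls [(Some (inv a), False)]"
      by (rule P.cls_relation)
    moreover have "P.cls [(None, False), (Some (inv a), True), (None, True)]
        = P.cls [(None, False)] \<otimes>\<^bsub>?P\<^esub> (\<alpha> (inv a) \<otimes>\<^bsub>?P\<^esub> \<xi>)"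
      using XN XS[OF iH[OF a]] by (simp add: \<alpha>_def \<xi>_def P.mult_cls)
    ultimately have "inv\<^bsub>?P\<^esub> \<xi> \<otimes>\<^bsub>?P\<^esub> (\<alpha> (inv a) \<otimes>\<^bsub>?P\<^esub> \<xi>) = inv\<^bsub>?P\<^esub> \<alpha> (inv a)"
      using P.cls_letter_inverse[OF XN] P.cls_letter_inverse[OF XS[OF iH[OF a]]]
      by (simp add: \<alpha>_def \<xi>_def)
    also have "\<dots> = \<alpha> a" using \<alpha>i[OF iH[OF a]] a HC by simp
    finally show ?thesis using \<alpha>c \<xi>c iH a by (simp add: PG.inv_solve_left')
  qed
  define nf where "nf = (\<lambda>r. if r \<in> H then [(Some r, True)] else [(Some (r \<otimes> inv x), True), (None, True)])"
  define \<psi> where "\<psi> = (\<lambda>r. P.cls (nf r))"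
  have nfX: "nf r \<in> gwords X" if "r \<in> carrier G" for r
    using that XS XN u1 by (auto simp: nf_def)
  have \<psi>H: "\<psi> r = \<alpha> r" if "r \<in> H" for r using that by (simp add: \<psi>_def nf_def \<alpha>_def)
  have \<psi>N: "\<psi> (h \<otimes> x) = \<alpha> h \<otimes>\<^bsub>?P\<^esub> \<xi>" and hx: "h \<otimes> x \<notin> H" if h: "h \<in> H" for h
  proof -
    show n: "h \<otimes> x \<notin> H"
    proof
      assume "h \<otimes> x \<in> H"
      then have "inv h \<otimes> (h \<otimes> x) \<in> H" using mH iH h by blast
      then show False using h HC x by (simp add: inv_mult_cancel)
    qed
    have "h \<otimes> x \<otimes> inv x = h" using h HC x by (simp add: m_assoc)
    then show "\<psi> (h \<otimes> x) = \<alpha> h \<otimes>\<^bsub>?P\<^esub> \<xi>"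
      using n XS[OF h] XN by (simp add: \<psi>_def nf_def \<alpha>_def \<xi>_def P.mult_cls)
  qed
  have split: "\<exists>h\<in>H. r = h \<otimes> x" if "r \<in> carrier G" "r \<notin> H" for r
    using u1[OF that] that x by (intro bexI[of _ "r \<otimes> inv x"]) (auto simp: m_assoc)
  have \<psi>m: "\<psi> (r \<otimes> s) = \<psi> r \<otimes>\<^bsub>?P\<^esub> \<psi> s" if r: "r \<in> carrier G" and s: "s \<in> carrier G" for r s
  proof (cases "r \<in> H"; cases "s \<in> H")
    assume "r \<in> H" "s \<in> H" then show ?thesis by (simp add: \<psi>H \<alpha>m mH)
  next
    assume h: "r \<in> H" "s \<notin> H"
    then obtain k where k: "k \<in> H" "s = k \<otimes> x" using split s by blast
    have "r \<otimes> s = (r \<otimes> k) \<otimes> x" using k h HC x by (simp add: m_assoc)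
    then show ?thesis using h k \<alpha>c \<xi>c by (simp add: \<psi>N \<psi>H mH \<alpha>m PG.m_assoc)
  next
    assume h: "r \<notin> H" "s \<in> H"
    then obtain k where k: "k \<in> H" "r = k \<otimes> x" using split r by blast
    have "r \<otimes> s = k \<otimes> (x \<otimes> s)" using k h HC x by (simp add: m_assoc)
    also have "x \<otimes> s = inv s \<otimes> x" using u2 x h by simp
    also have "k \<otimes> (inv s \<otimes> x) = (k \<otimes> inv s) \<otimes> x" using k h HC x by (simp add: m_assoc)
    finally have "\<psi> (r \<otimes> s) = \<alpha> k \<otimes>\<^bsub>?P\<^esub> (\<alpha> (inv s) \<otimes>\<^bsub>?P\<^esub> \<xi>)"
      using h k iH \<alpha>c \<xi>c by (simp add: \<psi>N mH \<alpha>m PG.m_assoc)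
    then show ?thesis using h k \<alpha>c \<xi>c by (simp add: \<psi>N \<psi>H \<xi>\<alpha>[symmetric] PG.m_assoc)
  next
    assume h: "r \<notin> H" "s \<notin> H"
    then obtain k l where k: "k \<in> H" "r = k \<otimes> x" and l: "l \<in> H" "s = l \<otimes> x"
      using split r s by blast
    have "r \<otimes> s = k \<otimes> (x \<otimes> l) \<otimes> x" using k l HC x by (simp add: m_assoc)
    also have "x \<otimes> l = inv l \<otimes> x" using u2 x l by simp
    also have "k \<otimes> (inv l \<otimes> x) \<otimes> x = k \<otimes> (inv l \<otimes> ?y)" using k l HC x by (simp add: m_assoc)
    finally have "\<psi> (r \<otimes> s) = \<alpha> k \<otimes>\<^bsub>?P\<^esub> (\<alpha> (inv l) \<otimes>\<^bsub>?P\<^esub> (\<xi> \<otimes>\<^bsub>?P\<^esub> \<xi>))"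
      using k l iH w by (simp add: \<psi>H mH \<alpha>m \<xi>2)
    also have "\<dots> = \<alpha> k \<otimes>\<^bsub>?P\<^esub> ((\<alpha> (inv l) \<otimes>\<^bsub>?P\<^esub> \<xi>) \<otimes>\<^bsub>?P\<^esub> \<xi>)"
      using k l iH \<alpha>c \<xi>c by (simp add: PG.m_assoc)
    finally show ?thesis using k l \<alpha>c \<xi>c by (simp add: \<psi>N \<xi>\<alpha>[symmetric] PG.m_assoc)
  qed
  have \<psi>c: "\<psi> r \<in> carrier ?P" if "r \<in> carrier G" for r
    using nfX[OF that] by (auto simp: \<psi>_def P.carrier_presented)
  interpret \<psi>: group_hom G ?P \<psi>
    by unfold_locales (auto simp: hom_def \<psi>c \<psi>m)
  have \<psi>x: "\<psi> x = \<xi>" using \<psi>N[OF oH] \<alpha>1 x \<xi>c by simp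
  \<comment> \<open>Surjectivity goes letter by letter: the image is closed under products and
    inverses and contains \<open>\<xi>\<close> and every \<open>\<alpha> a\<close>.\<close>
  have "P.cls u \<in> \<psi> ` carrier G" if "u \<in> gwords X" for u
    using that
  proof (induction u)
    case Nil
    have "\<psi> \<one> = P.cls []" using P.one_presented by simp
    then show ?case by (metis imageI one_closed)
  next
    case (Cons l u)
    then obtain s where s: "s \<in> carrier G" "P.cls u = \<psi> s" by auto
    obtain g b where l: "l = (g, b)" by force
    have g: "g \<in> X" using Cons.prems l by simp
    have "\<exists>r\<in>carrier G. P.cls [(g, True)] = \<psi> r"
    proof (cases g)
      case None
      then show ?thesis using \<psi>x x \<xi>_def by metis
    next
      case (Some a)
      then have "a \<in> H" using g A by (auto simp: X_def)
      then show ?thesis using Some \<psi>H HC \<alpha>_def by metis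
    qed
    then obtain r where r: "r \<in> carrier G" "P.cls [(g, True)] = \<psi> r" by blast
    have "\<exists>r\<in>carrier G. P.cls [l] = \<psi> r"
    proof (cases b)
      case True
      then show ?thesis using r l by auto
    next
      case False
      then have "P.cls [l] = \<psi> (inv r)" using P.cls_letter_inverse[OF g] r l by simp
      then show ?thesis using r by blast
    qed
    then obtain r' where r': "r' \<in> carrier G" "P.cls [l] = \<psi> r'" by blast
    have "P.cls (l # u) = P.cls [l] \<otimes>\<^bsub>?P\<^esub> P.cls u"
      using Cons.prems by (simp add: P.mult_cls)
    also have "\<dots> = \<psi> (r' \<otimes> s)" using r' s by simp
    finally show ?case using r' s by blast
  qed
  then have surj: "\<psi> ` carrier G = carrier ?P"
    using \<psi>c by (auto simp: P.carrier_presented)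
  \<comment> \<open>Reading each letter in \<open>G\<close> respects the relations, so evaluation is
    constant on classes; on \<open>nf r\<close> it returns \<open>r\<close>.\<close>
  define ev where "ev = (\<lambda>(g, b). let a = (case g of None \<Rightarrow> x | Some a \<Rightarrow> a) in if b then a else inv a)"
  have evS: "ev (Some a, True) = a" "ev (Some a, False) = inv a" for a by (auto simp: ev_def)
  have evN: "ev (None, True) = x" "ev (None, False) = inv x" by (auto simp: ev_def)
  have evc: "ev l \<in> carrier G" if "fst l \<in> X" for l
    using that x HC A by (cases l) (auto simp: ev_def X_def split: option.split)
  have ev_cong: "eval_word ev u = eval_word ev v" if "(u, v) \<in> pres_cong X \<R>" for u v
  proof (rule eval_word_cong[OF P.relations evc _ _ that])
    show "ev (g, b) \<otimes> ev (g, \<not> b) = \<one>" if "g \<in> X" for g b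
      using that x HC A by (cases b) (auto simp: ev_def X_def)
    show "eval_word ev l = eval_word ev r" if "(l, r) \<in> \<R>" for l r
    proof -
      have "inv x \<otimes> (a \<otimes> x) = inv a" if a: "a \<in> H" for a
      proof -
        have "x \<otimes> inv a = a \<otimes> x" using u2[OF x iH[OF a]] a HC by simp
        then show ?thesis using a HC x by (metis inv_closed inv_mult_cancel(1))
      qed
      then show ?thesis
        using \<open>(l, r) \<in> \<R>\<close> HC x A by (auto simp: \<R>_def dic_relations_def evS evN)
    qed
  qed
  have ev_nf: "eval_word ev (nf r) = r" if "r \<in> carrier G" for r
    using that x HC by (auto simp: nf_def evS evN m_assoc)
  have "inj_on \<psi> (carrier G)"
  proof (rule inj_onI)
    fix r s assume rs: "r \<in> carrier G" "s \<in> carrier G" "\<psi> r = \<psi> s"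
    then have "(nf r, nf s) \<in> pres_cong X \<R>" using nfX by (simp add: \<psi>_def P.cls_eq_iff)
    then have "eval_word ev (nf r) = eval_word ev (nf s)" by (rule ev_cong)
    then show "r = s" using ev_nf rs by simp
  qed
  then have "\<psi> \<in> iso G ?P"
    using surj \<psi>.homh by (auto simp: iso_def bij_betw_def)
  then have "G \<cong> dic_group A ?y" unfolding dic by (rule is_isoI)
  then show ?thesis
    unfolding generalised_dicyclic_def
    using cA fH evenA expA ordy w A by (intro exI[of _ A] exI[of _ ?y]) auto
qed

end

section \<open>The two cardinality bounds\<close>

theorem corollary1p7:
  fixes R :: "('a, 'b) monoid_scheme" and N :: "'a set"
  assumes "group R" and "finite (carrier R)"
    and "N \<lhd> R" and "N \<noteq> {\<one>\<^bsub>R\<^esub>}" and "N \<noteq> carrier R"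
  shows
    "real (card {S. S \<subseteq> carrier R \<and> S = set_inv\<^bsub>R\<^esub> S \<and>
        right_regular R (carrier R) = normalizer (cayley_aut R S) (right_regular R (carrier R)) \<and>
        (\<exists>f \<in> normalizer (cayley_aut R S) (right_regular R N).
           f \<noteq> \<one>\<^bsub>cayley_aut R S\<^esub> \<and> f \<one>\<^bsub>R\<^esub> = \<one>\<^bsub>R\<^esub> \<and> (\<forall>B \<in> right_orbits R N. f ` B = B))})
      \<le> 2 powr (cc R - sqrt (real (order R)) / 192 + 2 * log 2 (real (order R))
                 + (log 2 (real (order R)))\<^sup>2 + 3)
     \<and>
     (\<not> (comm_group R \<and> group_exponent R > 2) \<and> \<not> generalised_dicyclic R \<longrightarrow>
      real (card {S. S \<subseteq> carrier R \<and> S = set_inv\<^bsub>R\<^esub> S \<and>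
        (\<exists>f \<in> normalizer (cayley_aut R S) (right_regular R N).
           f \<noteq> \<one>\<^bsub>cayley_aut R S\<^esub> \<and> f \<one>\<^bsub>R\<^esub> = \<one>\<^bsub>R\<^esub> \<and> (\<forall>B \<in> right_orbits R N. f ` B = B))})
      \<le> 2 powr (cc R - sqrt (real (order R)) / 192 + 2 * log 2 (real (order R))
                 + (log 2 (real (order R)))\<^sup>2 + 3))"
    (is "real (card ?F1) \<le> ?b \<and> (?c \<longrightarrow> real (card ?F2) \<le> ?b)")
proof -
  interpret group R by fact
  note fin = \<open>finite (carrier R)\<close>
  have fF: "finite asymmetry_failures"
    by (rule finite_subset[of _ "Pow (carrier R)"]) (use fin in \<open>auto simp: asymmetry_failures_def\<close>)
  have F2: "?F2 \<subseteq> asymmetry_failures"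
  proof
    fix S assume "S \<in> ?F2"
    then obtain f where S: "S \<subseteq> carrier R" "S = set_inv\<^bsub>R\<^esub> S"
      and f: "f \<in> normalizer (cayley_aut R S) (right_regular R N)"
        "f \<noteq> \<one>\<^bsub>cayley_aut R S\<^esub>" "f \<one>\<^bsub>R\<^esub> = \<one>\<^bsub>R\<^esub>"
      by (elim CollectE conjE bexE) (rule that)
    show "S \<in> asymmetry_failures"
      by (rule mem_asymmetry_failures[OF S normalizer_subset[OF f(1)] f(2,3)])
  qed
  \<comment> \<open>The internal forms of the two exceptional classes. Outside them both sets are
    bounded through \<open>asymmetry_failures\<close>; inside them the first set is empty, and the
    premise of the second claim fails.\<close>
  let ?exceptional = "(\<exists>H. inverted_half H) \<or> (comm_group R \<and> (\<exists>y\<in>carrier R. y \<otimes>\<^bsub>R\<^esub> y \<noteq> \<one>\<^bsub>R\<^esub>))"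
  show ?thesis
  proof (cases ?exceptional)
    case False
    then have b: "real (card asymmetry_failures) \<le> ?b"
      by (intro card_asymmetry_failures[OF fin]) auto
    have "card ?F2 \<le> card asymmetry_failures" by (rule card_mono[OF fF F2])
    moreover have "?F1 \<subseteq> ?F2"
      by (rule Collect_mono, intro impI, elim conjE, intro conjI)
    with F2 have "?F1 \<subseteq> asymmetry_failures" by (rule subset_trans[rotated])
    then have "card ?F1 \<le> card asymmetry_failures" by (rule card_mono[OF fF])
    ultimately show ?thesis using b by linarith
  next
    case True
    have "?F1 = {}"
    proof -
      obtain \<phi> z where \<phi>: "\<And>a b. a \<in> carrier R \<Longrightarrow> b \<in> carrier R \<Longrightarrow> \<phi> (a \<otimes>\<^bsub>R\<^esub> b) = \<phi> a \<otimes>\<^bsub>R\<^esub> \<phi> b"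
        "\<And>y. y \<in> carrier R \<Longrightarrow> \<phi> y \<in> inv_pair y" and z: "z \<in> carrier R" "\<phi> z \<noteq> z"
      proof (cases "\<exists>H. inverted_half H")
        case True
        then show thesis using inverted_half_automorphism that by metis
      next
        case False
        then obtain y where c: "comm_group R" and y: "y \<in> carrier R" "y \<otimes>\<^bsub>R\<^esub> y \<noteq> \<one>\<^bsub>R\<^esub>" using True by blast
        interpret comm_group R by fact
        \<comment> \<open>In the abelian case inversion is the automorphism, and it moves
          \<open>y\<close> because the square of \<open>y\<close> is not the identity.\<close>
        have "inv\<^bsub>R\<^esub> y \<noteq> y" using y by (metis r_inv)
        then show thesis using y by (intro that[of "\<lambda>a. inv\<^bsub>R\<^esub> a" y]) (auto simp: inv_mult inv_pair_def)
      qed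
      show ?thesis
      proof (rule equals0I)
        fix S assume "S \<in> ?F1"
        note S = this[unfolded mem_Collect_eq]
        have "right_regular R (carrier R) \<noteq> normalizer (cayley_aut R S) (right_regular R (carrier R))"
          by (rule right_regular_neq_normalizer[OF conjunct1[OF S] conjunct1[OF conjunct2[OF S]] \<phi> z])
        then show False using conjunct1[OF conjunct2[OF conjunct2[OF S]]] by (rule notE)
      qed
    qed
    then have "card ?F1 = 0" by (simp only: card.empty)
    then have "real (card ?F1) \<le> ?b" by (simp only: of_nat_0 powr_ge_zero)
    moreover have "\<not> ?c"
      using True generalised_dicyclic_if_inverted_half[OF fin] group_exponent_gt_two[OF fin] by blast
    ultimately show ?thesis by blast
  qed
qed

end
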